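(* Let $(\mathscr{A},\mathscr{B})$ be a taut, filling Heegaard diagram of a Heegaard splitting with splitting surface $\Sigma_g$. Then the square complex structure on $\Sigma_g$ dual to the diagram is virtually special.
   Context: A Heegaard splitting of genus $g$ of a closed orientable 3-manifold $M$ is a decomposition $M=\mathcal{H}_1\cup\mathcal{H}_2$ into two genus-$g$ handlebodies intersecting exactly in their common boundary $\Sigma_g$. A Heegaard diagram for it is a pair $(\mathscr{A},\mathscr{B})$ of sets of $g$ curves on $\Sigma_g$, where $\mathscr{A}$ (resp. $\mathscr{B}$) consists of $g$ disjoint simple closed curves that are homologically non-trivial and independent, represent a basis of a Lagrangian subspace of homology, and are null-homotopic in $\mathcal{H}_1$ (resp. $\mathcal{H}_2$). The diagram is filling if the complement of all its curves in $\Sigma_g$ is a finite union of open discs. The curves then give a cell decomposition of $\Sigma_g$ with quadrivalent vertices (the intersection points), and the dual cell decomposition is a square complex: one square per intersection point, one vertex per complementary disc. Sides and tautness: a small annular neighbourhood of a simple closed curve $\gamma$, with $\gamma$ removed, has two components; these determine the two sides of $\gamma$. The number of connected components in which a set $X$ intersects a side of $\gamma$ is the limit as $\epsilon\to0$ of the number of components of $X\cap A_\epsilon$, where $A_\epsilon$ is the part of the $\epsilon$-neighbourhood of $\gamma$ on that side. A Heegaard diagram is taut if every connected component of the complement of the diagram intersects each side of each diagram curve in at most one connected component. Special square complexes: call two edges parallel if they are related by the equivalence relation generated by being opposite edges of a square. A hyperplane is a connected component obtained by joining the midlines of squares across parallel edges; the edges in the corresponding parallelism class are dual to it. A hyperplane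 embeds if it does not cross itself (no square has two adjacent edges dual to it). For a two-sided hyperplane, orient its dual edges consistently (opposite edges of squares are oriented in parallel). It directly self-osculates if two distinct dual edges have a common initial vertex, or a common terminal vertex, without forming the corner of a square there; it indirectly self-osculates if the terminal vertex of one dual edge is the initial vertex of a dual edge, without these forming the corner of a square there. A square complex is special if each hyperplane embeds, no hyperplane directly self-osculates, and no hyperplane indirectly self-osculates. It is virtually special if it has a finite-sheeted cover that is special. *)

theory Defs
  imports "HOL-Analysis.Analysis" "HOL-Homology.Homology"
begin

section \<open>Heegaard splittings\<close>

text \<open>Local orientations are generators of $H_n(M, M - \{x\})$; they have to be locally induced by
  a class of $H_n(M, M - U)$.\<close>

definition is_generator :: "('a, 'm) monoid_scheme \<Rightarrow> 'a \<Rightarrow> bool" where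
  "is_generator G u \<longleftrightarrow> u \<in> carrier G \<and> carrier G = range (\<lambda>k::int. u [^]\<^bsub>G\<^esub> k)"

definition closed_manifold :: "nat \<Rightarrow> 'a topology \<Rightarrow> bool" where
  "closed_manifold n M \<longleftrightarrow>
     compact_space M \<and> Hausdorff_space M \<and> second_countable M \<and>
     (\<forall>x \<in> topspace M. \<exists>U. openin M U \<and> x \<in> U \<and>
        subtopology M U homeomorphic_space Euclidean_space n)"

definition orientable :: "nat \<Rightarrow> 'a topology \<Rightarrow> bool" where
  "orientable n M \<longleftrightarrow>
     (\<exists>\<mu>. (\<forall>x \<in> topspace M.
            is_generator (relative_homology_group (int n) M (topspace M - {x})) (\<mu> x)) \<and>
          (\<forall>x \<in> topspace M. \<exists>U c. openin M U \<and> x \<in> U \<and>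
            c \<in> carrier (relative_homology_group (int n) M (topspace M - U)) \<and>
            (\<forall>y \<in> U. hom_induced (int n) M (topspace M - U) M (topspace M - {y}) id c = \<mu> y)))"

text \<open>The standard handlebody of genus $g$: a disc with $g$ holes times an interval.  As a
  codimension-0 submanifold of $\mathbb{R}^3$, its boundary surface is its topological frontier.\<close>

definition std_handlebody :: "nat \<Rightarrow> (complex \<times> real) set" where
  "std_handlebody g =
     {z. cmod z \<le> 3 * real g + 2 \<and> (\<forall>i<g. 1 \<le> dist z (of_real (3 * (real i + 1))))} \<times> {0..1}"

definition handlebody_with_boundary :: "nat \<Rightarrow> 'a topology \<Rightarrow> 'a set \<Rightarrow> 'a set \<Rightarrow> bool" where
  "handlebody_with_boundary g M H S \<longleftrightarrow> H \<subseteq> topspace M \<and>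
     (\<exists>f. homeomorphic_map (top_of_set (std_handlebody g)) (subtopology M H) f \<and>
          f ` frontier (std_handlebody g) = S)"

definition heegaard_splitting :: "nat \<Rightarrow> 'a topology \<Rightarrow> 'a set \<Rightarrow> 'a set \<Rightarrow> 'a set \<Rightarrow> bool" where
  "heegaard_splitting g M H1 H2 S \<longleftrightarrow>
     closed_manifold 3 M \<and> orientable 3 M \<and>
     handlebody_with_boundary g M H1 S \<and> handlebody_with_boundary g M H2 S \<and>
     H1 \<union> H2 = topspace M \<and> H1 \<inter> H2 = S"


section \<open>Curves on surfaces\<close>

abbreviation circle :: "complex set" where
  "circle \<equiv> sphere 0 1"

definition parametrizes :: "'a topology \<Rightarrow> (complex \<Rightarrow> 'a) \<Rightarrow> 'a set \<Rightarrow> bool" where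
  "parametrizes X f \<gamma> \<longleftrightarrow> embedding_map (top_of_set circle) X f \<and> f ` circle = \<gamma>"

definition simple_closed_curve :: "'a topology \<Rightarrow> 'a set \<Rightarrow> bool" where
  "simple_closed_curve X \<gamma> \<longleftrightarrow> (\<exists>f. parametrizes X f \<gamma>)"

definition crosses_at :: "'a topology \<Rightarrow> 'a set \<Rightarrow> 'a set \<Rightarrow> 'a \<Rightarrow> bool" where
  "crosses_at X \<gamma> \<delta> p \<longleftrightarrow>
     (\<exists>U f. openin X U \<and> homeomorphic_map (euclidean :: complex topology) (subtopology X U) f \<and>
        f 0 = p \<and> f ` {z. Im z = 0} = \<gamma> \<inter> U \<and> f ` {z. Re z = 0} = \<delta> \<inter> U)"

text \<open>A curve is a set of points; its class in $H_1(X;\mathbb{Z})$ is defined up to sign, according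
  to the choice of an orientation.\<close>

definition class_of_curve :: "'a topology \<Rightarrow> 'a set \<Rightarrow> 'a chain set \<Rightarrow> bool" where
  "class_of_curve X \<gamma> c \<longleftrightarrow>
     (\<exists>f u. parametrizes X f \<gamma> \<and> is_generator (homology_group 1 (top_of_set circle)) u \<and>
        c = hom_induced 1 (top_of_set circle) {} X {} f u)"

definition null_homotopic_in :: "'a topology \<Rightarrow> 'a set \<Rightarrow> bool" where
  "null_homotopic_in Y \<gamma> \<longleftrightarrow>
     (\<exists>f a. parametrizes Y f \<gamma> \<and>
        homotopic_with (\<lambda>_. True) (top_of_set circle) Y f (\<lambda>_. a))"

text \<open>The algebraic intersection form of a closed connected orientable surface.  The conditions
  determine it up to a global sign, that is, up to the choice of an orientation; Lagrangian
  subgroups do not depend on this sign.\<close>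

definition intersection_form :: "'a topology \<Rightarrow> ('a chain set \<Rightarrow> 'a chain set \<Rightarrow> int) \<Rightarrow> bool" where
  "intersection_form X \<omega> \<longleftrightarrow>
     (\<forall>x \<in> carrier (homology_group 1 X). \<forall>y \<in> carrier (homology_group 1 X).
        \<omega> x y = - \<omega> y x \<and>
        (\<forall>z \<in> carrier (homology_group 1 X). \<omega> (x \<otimes>\<^bsub>homology_group 1 X\<^esub> y) z = \<omega> x z + \<omega> y z)) \<and>
     (\<forall>\<gamma> \<delta> c d. class_of_curve X \<gamma> c \<and> class_of_curve X \<delta> d \<longrightarrow>
        (\<gamma> \<inter> \<delta> = {} \<longrightarrow> \<omega> c d = 0) \<and>
        (\<forall>p. \<gamma> \<inter> \<delta> = {p} \<and> crosses_at X \<gamma> \<delta> p \<longrightarrow> \<bar>\<omega> c d\<bar> = 1))"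

definition lagrangian :: "'a topology \<Rightarrow> 'a chain set set \<Rightarrow> bool" where
  "lagrangian X L \<longleftrightarrow> subgroup L (homology_group 1 X) \<and>
     (\<exists>\<omega>. intersection_form X \<omega> \<and>
          L = {x \<in> carrier (homology_group 1 X). \<forall>y \<in> L. \<omega> x y = 0})"

text \<open>Homology is written multiplicatively in the library.\<close>

definition independent_classes :: "'a topology \<Rightarrow> 'i set \<Rightarrow> ('i \<Rightarrow> 'a chain set) \<Rightarrow> bool" where
  "independent_classes X I c \<longleftrightarrow>
     (\<forall>k :: 'i \<Rightarrow> int.
        finprod (homology_group 1 X) (\<lambda>i. c i [^]\<^bsub>homology_group 1 X\<^esub> k i) I
          = \<one>\<^bsub>homology_group 1 X\<^esub> \<longrightarrow> (\<forall>i \<in> I. k i = 0))"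


section \<open>Heegaard diagrams\<close>

definition handlebody_curves ::
    "nat \<Rightarrow> 'a topology \<Rightarrow> 'a set \<Rightarrow> 'a set \<Rightarrow> 'a set set \<Rightarrow> bool" where
  "handlebody_curves g M H S \<A> \<longleftrightarrow>
     finite \<A> \<and> card \<A> = g \<and> disjoint \<A> \<and>
     (\<forall>\<gamma> \<in> \<A>. simple_closed_curve (subtopology M S) \<gamma> \<and> null_homotopic_in (subtopology M H) \<gamma>) \<and>
     (\<exists>c. (\<forall>\<gamma> \<in> \<A>. class_of_curve (subtopology M S) \<gamma> (c \<gamma>) \<and>
                   c \<gamma> \<noteq> \<one>\<^bsub>homology_group 1 (subtopology M S)\<^esub>) \<and>
          independent_classes (subtopology M S) \<A> c \<and>
          lagrangian (subtopology M S) (generate (homology_group 1 (subtopology M S)) (c ` \<A>)))"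

definition heegaard_diagram ::
    "nat \<Rightarrow> 'a topology \<Rightarrow> 'a set \<Rightarrow> 'a set \<Rightarrow> 'a set \<Rightarrow> 'a set set \<Rightarrow> 'a set set \<Rightarrow> bool" where
  "heegaard_diagram g M H1 H2 S \<A> \<B> \<longleftrightarrow>
     handlebody_curves g M H1 S \<A> \<and> handlebody_curves g M H2 S \<B> \<and>
     (\<forall>\<alpha> \<in> \<A>. \<forall>\<beta> \<in> \<B>. \<forall>p \<in> \<alpha> \<inter> \<beta>. crosses_at (subtopology M S) \<alpha> \<beta> p)"

text \<open>From here on, \<open>X\<close> is the surface \<open>subtopology M S\<close>.\<close>

definition regions :: "'a topology \<Rightarrow> 'a set set \<Rightarrow> 'a set set \<Rightarrow> 'a set set" where
  "regions X \<A> \<B> = connected_components_of (subtopology X (topspace X - \<Union>(\<A> \<union> \<B>)))"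

definition filling :: "'a topology \<Rightarrow> 'a set set \<Rightarrow> 'a set set \<Rightarrow> bool" where
  "filling X \<A> \<B> \<longleftrightarrow> finite (regions X \<A> \<B>) \<and>
     (\<forall>U \<in> regions X \<A> \<B>. subtopology X U homeomorphic_space top_of_set (ball (0::complex) 1))"

text \<open>A parametrized annular neighbourhood of \<open>\<gamma>\<close>, small enough that the diagram meets it only
  in \<open>\<gamma>\<close> and in one fibre for each point at which another curve crosses \<open>\<gamma>\<close>.  Since the curves
  cross transversally, every curve of a diagram on an orientable surface has one.  (For
  neighbourhoods not adapted to the crossing curves in this way, the number of components of the
  intersection of a region with a shrinking neighbourhood need not stabilize.)\<close>

definition annular_neighbourhood ::
    "'a topology \<Rightarrow> 'a set set \<Rightarrow> 'a set set \<Rightarrow> 'a set \<Rightarrow> (complex \<times> real \<Rightarrow> 'a) \<Rightarrow> bool" where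
  "annular_neighbourhood X \<A> \<B> \<gamma> f \<longleftrightarrow>
     embedding_map (top_of_set (circle \<times> {-1<..<1})) X f \<and>
     openin X (f ` (circle \<times> {-1<..<1})) \<and>
     f ` (circle \<times> {0}) = \<gamma> \<and>
     (\<exists>C. finite C \<and> C \<subseteq> circle \<and>
        f ` (circle \<times> {-1<..<1}) \<inter> \<Union>(\<A> \<union> \<B>) = f ` (circle \<times> {0} \<union> C \<times> {-1<..<1}))"

definition annular_neighbourhoods ::
    "'a topology \<Rightarrow> 'a set set \<Rightarrow> 'a set set \<Rightarrow> ('a set \<Rightarrow> complex \<times> real \<Rightarrow> 'a) \<Rightarrow> bool" where
  "annular_neighbourhoods X \<A> \<B> h \<longleftrightarrow> (\<forall>\<gamma> \<in> \<A> \<union> \<B>. annular_neighbourhood X \<A> \<B> \<gamma> (h \<gamma>))"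

text \<open>The two sides of a curve are named \<open>True\<close> (positive) and \<open>False\<close> (negative), according to the
  second coordinate in its annular neighbourhood.\<close>

definition sg :: "bool \<Rightarrow> real" where
  "sg s = (if s then 1 else -1)"

definition side_part :: "(complex \<times> real \<Rightarrow> 'a) \<Rightarrow> bool \<Rightarrow> real \<Rightarrow> 'a set" where
  "side_part f s \<epsilon> = f ` (circle \<times> {y. 0 < sg s * y \<and> sg s * y < \<epsilon>})"

text \<open>A limit of natural numbers is an eventual value.  Finiteness is demanded because \<open>card\<close>
  is \<open>0\<close> on infinite sets.\<close>

definition meets_side_in_components ::
    "'a topology \<Rightarrow> (complex \<times> real \<Rightarrow> 'a) \<Rightarrow> bool \<Rightarrow> 'a set \<Rightarrow> nat \<Rightarrow> bool" where
  "meets_side_in_components X f s U n \<longleftrightarrow>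
     (\<forall>\<^sub>F \<epsilon> in at_right 0.
        finite (connected_components_of (subtopology X (U \<inter> side_part f s \<epsilon>))) \<and>
        card (connected_components_of (subtopology X (U \<inter> side_part f s \<epsilon>))) = n)"

definition taut ::
    "'a topology \<Rightarrow> 'a set set \<Rightarrow> 'a set set \<Rightarrow> ('a set \<Rightarrow> complex \<times> real \<Rightarrow> 'a) \<Rightarrow> bool" where
  "taut X \<A> \<B> h \<longleftrightarrow>
     (\<forall>U \<in> regions X \<A> \<B>. \<forall>\<gamma> \<in> \<A> \<union> \<B>. \<forall>s. \<exists>n \<le> 1. meets_side_in_components X (h \<gamma>) s U n)"


section \<open>Square complexes\<close>

text \<open>Every edge is represented by two darts, its two orientations, exchanged by \<open>flip\<close>.  The
  attaching map of a square \<open>q\<close> is the closed path of darts \<open>bdry q 0, \<dots>, bdry q 3\<close>; only the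
  values at indices below 4 are relevant.\<close>

record ('v, 'd, 'q) square_complex =
  verts :: "'v set"
  darts :: "'d set"
  src :: "'d \<Rightarrow> 'v"
  flip :: "'d \<Rightarrow> 'd"
  squares :: "'q set"
  bdry :: "'q \<Rightarrow> nat \<Rightarrow> 'd"

definition tgt :: "('v, 'd, 'q) square_complex \<Rightarrow> 'd \<Rightarrow> 'v" where
  "tgt K d = src K (flip K d)"

definition is_square_complex :: "('v, 'd, 'q) square_complex \<Rightarrow> bool" where
  "is_square_complex K \<longleftrightarrow>
     (\<forall>d \<in> darts K. src K d \<in> verts K \<and> flip K d \<in> darts K \<and> flip K d \<noteq> d \<and> flip K (flip K d) = d) \<and>
     (\<forall>q \<in> squares K. \<forall>i<4. bdry K q i \<in> darts K \<and>
        tgt K (bdry K q i) = src K (bdry K q ((i + 1) mod 4)))"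

text \<open>\<open>codirected\<close> is parallelism of oriented edges: opposite edges of a square are oriented in
  parallel, i.e.\ one of them against the direction of the boundary path.\<close>

definition opposite :: "('v, 'd, 'q) square_complex \<Rightarrow> 'd \<Rightarrow> 'd \<Rightarrow> bool" where
  "opposite K a b \<longleftrightarrow>
     (\<exists>q \<in> squares K. \<exists>i<4. a = bdry K q i \<and> b = flip K (bdry K q ((i + 2) mod 4)))"

definition codirected :: "('v, 'd, 'q) square_complex \<Rightarrow> 'd \<Rightarrow> 'd \<Rightarrow> bool" where
  "codirected K = equivclp (opposite K)"

definition parallel :: "('v, 'd, 'q) square_complex \<Rightarrow> 'd \<Rightarrow> 'd \<Rightarrow> bool" where
  "parallel K a b \<longleftrightarrow> codirected K a b \<or> codirected K a (flip K b)"

definition corner :: "('v, 'd, 'q) square_complex \<Rightarrow> 'd \<Rightarrow> 'd \<Rightarrow> bool" where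
  "corner K a b \<longleftrightarrow>
     (\<exists>q \<in> squares K. \<exists>i<4. {a, b} = {flip K (bdry K q i), bdry K q ((i + 1) mod 4)})"

text \<open>The following predicates concern the hyperplane dual to the edge of the dart \<open>d\<close>; if it is
  two-sided, \<open>d\<close> orients it.\<close>

definition two_sided :: "('v, 'd, 'q) square_complex \<Rightarrow> 'd \<Rightarrow> bool" where
  "two_sided K d \<longleftrightarrow> \<not> codirected K d (flip K d)"

definition embeds :: "('v, 'd, 'q) square_complex \<Rightarrow> 'd \<Rightarrow> bool" where
  "embeds K d \<longleftrightarrow>
     \<not> (\<exists>q \<in> squares K. \<exists>i<4. parallel K d (bdry K q i) \<and> parallel K d (bdry K q ((i + 1) mod 4)))"

definition directly_self_osculates :: "('v, 'd, 'q) square_complex \<Rightarrow> 'd \<Rightarrow> bool" where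
  "directly_self_osculates K d \<longleftrightarrow>
     (\<exists>a \<in> darts K. \<exists>b \<in> darts K. codirected K d a \<and> codirected K d b \<and> a \<noteq> b \<and>
        (src K a = src K b \<and> \<not> corner K a b \<or>
         tgt K a = tgt K b \<and> \<not> corner K (flip K a) (flip K b)))"

text \<open>The two darts may coincide here: a loop makes its hyperplane self-osculate indirectly.\<close>

definition indirectly_self_osculates :: "('v, 'd, 'q) square_complex \<Rightarrow> 'd \<Rightarrow> bool" where
  "indirectly_self_osculates K d \<longleftrightarrow>
     (\<exists>a \<in> darts K. \<exists>b \<in> darts K. codirected K d a \<and> codirected K d b \<and>
        tgt K a = src K b \<and> \<not> corner K (flip K a) b)"

definition special :: "('v, 'd, 'q) square_complex \<Rightarrow> bool" where
  "special K \<longleftrightarrow> is_square_complex K \<and>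
     (\<forall>d \<in> darts K. two_sided K d \<and> embeds K d \<and>
        \<not> directly_self_osculates K d \<and> \<not> indirectly_self_osculates K d)"

text \<open>Coverings are the surjective combinatorial maps inducing isomorphisms of links of vertices.
  The attaching maps of the squares of a covering complex are lifts of those of the base, so they
  may be labelled by the same indices.\<close>

definition covering_map ::
    "('v, 'd, 'q) square_complex \<Rightarrow> ('w, 'e, 'r) square_complex \<Rightarrow>
     ('v \<Rightarrow> 'w) \<Rightarrow> ('d \<Rightarrow> 'e) \<Rightarrow> ('q \<Rightarrow> 'r) \<Rightarrow> bool" where
  "covering_map L K pv pd pq \<longleftrightarrow>
     pv ` verts L = verts K \<and> pd ` darts L \<subseteq> darts K \<and> pq ` squares L \<subseteq> squares K \<and>
     (\<forall>d \<in> darts L. src K (pd d) = pv (src L d) \<and> flip K (pd d) = pd (flip L d)) \<and>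
     (\<forall>q \<in> squares L. \<forall>i<4. bdry K (pq q) i = pd (bdry L q i)) \<and>
     (\<forall>v \<in> verts L.
        bij_betw pd {d \<in> darts L. src L d = v} {d \<in> darts K. src K d = pv v} \<and>
        (\<forall>i<4. bij_betw pq {q \<in> squares L. src L (bdry L q i) = v}
                           {q \<in> squares K. src K (bdry K q i) = pv v}))"

text \<open>The type of the covering complex is no restriction: as fibres are finite, its cells can be
  labelled by a cell of the base and a number.\<close>

definition virtually_special :: "('v, 'd, 'q) square_complex \<Rightarrow> bool" where
  "virtually_special K \<longleftrightarrow> is_square_complex K \<and>
     (\<exists>(L :: ('v \<times> nat, 'd \<times> nat, 'q \<times> nat) square_complex) pv pd pq.
        covering_map L K pv pd pq \<and> (\<forall>v \<in> verts K. finite {w \<in> verts L. pv w = v}) \<and> special L)"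


section \<open>The square complex dual to a diagram\<close>

definition crossings :: "'a set set \<Rightarrow> 'a set set \<Rightarrow> 'a set" where
  "crossings \<A> \<B> = \<Union>\<A> \<inter> \<Union>\<B>"

definition arcs :: "'a topology \<Rightarrow> 'a set set \<Rightarrow> 'a set set \<Rightarrow> 'a set set" where
  "arcs X \<A> \<B> = connected_components_of (subtopology X (\<Union>(\<A> \<union> \<B>) - crossings \<A> \<B>))"

definition curve_of_arc :: "'a set set \<Rightarrow> 'a set set \<Rightarrow> 'a set \<Rightarrow> 'a set" where
  "curve_of_arc \<A> \<B> e = (THE \<gamma>. \<gamma> \<in> \<A> \<union> \<B> \<and> e \<subseteq> \<gamma>)"

text \<open>The region adjacent to the arc \<open>e\<close> on side \<open>s\<close>.  It may be the same on both sides.\<close>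

definition region_beside ::
    "'a topology \<Rightarrow> 'a set set \<Rightarrow> 'a set set \<Rightarrow> ('a set \<Rightarrow> complex \<times> real \<Rightarrow> 'a) \<Rightarrow>
     'a set \<Rightarrow> bool \<Rightarrow> 'a set" where
  "region_beside X \<A> \<B> h e s =
     (THE U. U \<in> regions X \<A> \<B> \<and>
        (\<forall>z \<in> circle. \<forall>y. h (curve_of_arc \<A> \<B> e) (z, 0) \<in> e \<and> 0 < y \<and> y < 1 \<longrightarrow>
            h (curve_of_arc \<A> \<B> e) (z, sg s * y) \<in> U))"

definition position :: "(complex \<times> real \<Rightarrow> 'a) \<Rightarrow> 'a \<Rightarrow> complex" where
  "position f p = (THE z. z \<in> circle \<and> f (z, 0) = p)"

text \<open>The arc of \<open>\<gamma>\<close> that leaves the crossing \<open>p\<close> forwards (\<open>True\<close>) or backwards (\<open>False\<close>), with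
  respect to the orientation of \<open>\<gamma>\<close> given by its parametrization.\<close>

definition arc_from ::
    "'a topology \<Rightarrow> 'a set set \<Rightarrow> 'a set set \<Rightarrow> ('a set \<Rightarrow> complex \<times> real \<Rightarrow> 'a) \<Rightarrow>
     'a set \<Rightarrow> 'a \<Rightarrow> bool \<Rightarrow> 'a set" where
  "arc_from X \<A> \<B> h \<gamma> p r =
     (THE e. e \<in> arcs X \<A> \<B> \<and>
        (\<forall>\<^sub>F t in at_right 0. h \<gamma> (position (h \<gamma>) p * cis (sg r * t), 0) \<in> e))"

text \<open>The side of \<open>\<gamma>\<close> to which \<open>\<delta>\<close> goes when it crosses \<open>\<gamma>\<close> at \<open>p\<close>.\<close>

definition side_entered ::
    "('a set \<Rightarrow> complex \<times> real \<Rightarrow> 'a) \<Rightarrow> 'a set \<Rightarrow> 'a set \<Rightarrow> 'a \<Rightarrow> bool" where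
  "side_entered h \<gamma> \<delta> p \<longleftrightarrow>
     (\<forall>\<^sub>F t in at_right 0. h \<delta> (position (h \<delta>) p * cis t, 0) \<in> side_part (h \<gamma>) True 1)"

text \<open>Vertices are the regions, edges are the arcs, squares are the crossings.  The dart \<open>(e, s)\<close>
  is the edge dual to the arc \<open>e\<close>, traversed towards side \<open>s\<close> of the curve containing \<open>e\<close>.

  The boundary of the square dual to a crossing \<open>p\<close> of \<open>\<alpha>\<close> and \<open>\<beta>\<close> is a loop around \<open>p\<close> that
  starts between the backward arc of \<open>\<beta>\<close> and the forward arc of \<open>\<alpha>\<close>.  It crosses the forward arc
  of \<open>\<alpha>\<close> towards the forward arc of \<open>\<beta>\<close>, the latter away from the forward arc of \<open>\<alpha>\<close>, and then
  the backward arcs of \<open>\<alpha>\<close> and \<open>\<beta>\<close> in the opposite directions.\<close>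

definition dual_square_complex ::
    "'a topology \<Rightarrow> 'a set set \<Rightarrow> 'a set set \<Rightarrow> ('a set \<Rightarrow> complex \<times> real \<Rightarrow> 'a) \<Rightarrow>
     ('a set, 'a set \<times> bool, 'a) square_complex" where
  "dual_square_complex X \<A> \<B> h =
     \<lparr> verts = regions X \<A> \<B>,
       darts = arcs X \<A> \<B> \<times> UNIV,
       src = (\<lambda>(e, s). region_beside X \<A> \<B> h e (\<not> s)),
       flip = (\<lambda>(e, s). (e, \<not> s)),
       squares = crossings \<A> \<B>,
       bdry = (\<lambda>p i.
         let \<alpha> = (THE \<alpha>. \<alpha> \<in> \<A> \<and> p \<in> \<alpha>);
             \<beta> = (THE \<beta>. \<beta> \<in> \<B> \<and> p \<in> \<beta>);
             s = side_entered h \<alpha> \<beta> p;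
             t = side_entered h \<beta> \<alpha> p
         in [(arc_from X \<A> \<B> h \<alpha> p True, s), (arc_from X \<A> \<B> h \<beta> p True, \<not> t),
             (arc_from X \<A> \<B> h \<alpha> p False, \<not> s), (arc_from X \<A> \<B> h \<beta> p False, t)] ! i) \<rparr>"

end

theory Submission
  imports Defs
begin

text \<open>The edges of the dual square complex cross the curves of the diagram, and all edges dual to one
  hyperplane cross the same curve; if they are oriented consistently, they cross it towards the same
  side.  A square is dual to a crossing of two distinct curves, so a hyperplane cannot cross itself.
  Being taut means that a region lies beside at most one arc of a given curve on a given side of it.
  Hence two distinct consistently oriented dual edges of a hyperplane
  never start, and never end, at the same vertex, and there is no direct self-osculation.

  Indirect self-osculations do occur, namely when a region touches both sides of a curve.  They
  disappear in the finite cover whose sheets are the subsets of the set of curves, where crossing a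
  curve adds this curve to the subset or removes it.  (This is the cover given by the intersection
  numbers modulo 2 with the curves.)  The boundary path of a square crosses each of two curves twice,
  so squares lift.  Edges dual to the same hyperplane of the cover, oriented consistently, all start
  in sheets that contain the curve which they cross and end in sheets that do not contain it, or all
  do the opposite; so none of them ends where another one starts.  This combinatorial argument is
  carried out in the locale \<open>labelled_square_complex\<close>.

  The topological part has to supply its hypotheses.  The lemma \<open>taut_same_side_unique\<close> translates
  tautness into uniqueness of arcs.  The lemma \<open>quadrant_region\<close> shows that the boundary path of a
  square is a path at all: two consecutive edges have to pass through the same region.  Its proof
  compares the coordinates that the annular neighbourhoods of two curves provide at a crossing.
  Either curve is the second axis in the coordinates of the other one (\<open>chart_in_crossing_curve_iff\<close>),
  so the coordinate change exchanges the axes, hence maps quadrants into quadrants, and its signs are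
  the sides which the curves enter (\<open>crossing_transition\<close>).\<close>

section \<open>Unfolding indirect self-osculations in a finite cover\<close>

text \<open>The sheets visited by the lift of the boundary path of a square that starts in sheet \<open>n\<close>;
  \<open>l i\<close> is the label of the \<open>i\<close>-th boundary edge.  Opposite edges have the same label, so two labels
  suffice and the fourth edge leads back to sheet \<open>n\<close>.\<close>

definition sheet_at_corner :: "(nat \<Rightarrow> nat) \<Rightarrow> nat \<Rightarrow> nat \<Rightarrow> nat" where
  "sheet_at_corner l n i =
     [n, flip_bit (l 0) n, flip_bit (l 1) (flip_bit (l 0) n), flip_bit (l 1) n] ! i"

text \<open>The cover with monodromy in $(\mathbb{Z}/2)^k$ that counts modulo 2 how often a path crosses
  each of \<open>k\<close> families of hyperplanes.  A sheet is a bit vector, encoded as a number below $2^k$;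
  crossing an edge with label \<open>l\<close> flips bit \<open>l\<close>.\<close>

definition sheet_cover ::
    "nat \<Rightarrow> ('d \<Rightarrow> nat) \<Rightarrow> ('v, 'd, 'q) square_complex \<Rightarrow>
     ('v \<times> nat, 'd \<times> nat, 'q \<times> nat) square_complex" where
  "sheet_cover k lab K =
     \<lparr> verts = verts K \<times> {..<2 ^ k},
       darts = darts K \<times> {..<2 ^ k},
       src = (\<lambda>(d, n). (src K d, n)),
       flip = (\<lambda>(d, n). (flip K d, flip_bit (lab d) n)),
       squares = squares K \<times> {..<2 ^ k},
       bdry = (\<lambda>(q, n) i. (bdry K q i, sheet_at_corner (lab \<circ> bdry K q) n i)) \<rparr>"

lemma flip_bit_flip_bit [simp]: "flip_bit l (flip_bit l n) = (n :: nat)"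
  by (rule bit_eqI) (auto simp: bit_flip_bit_iff)

lemma flip_bit_commute: "flip_bit l (flip_bit m n) = flip_bit m (flip_bit l (n :: nat))"
  by (rule bit_eqI) (auto simp: bit_flip_bit_iff)

lemma flip_bit_less [simp]: "flip_bit l n < 2 ^ k" if "l < k" "n < 2 ^ k" for n :: nat
proof -
  have "take_bit k (flip_bit l n) = flip_bit l n"
    using that by (simp add: take_bit_flip_bit_eq take_bit_nat_eq_self)
  then show ?thesis
    by (metis take_bit_nat_less_exp)
qed

lemma less_4_cases: "i < 4 \<Longrightarrow> i = 0 \<or> i = 1 \<or> i = 2 \<or> i = (3 :: nat)"
  by auto

text \<open>\<open>lab\<close> names the hyperplane family dual to an edge and \<open>side\<close> one of the two directions in
  which to cross it.  Several hyperplanes may share a label, but by the last condition two edges with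
  the same label cannot leave a vertex in the same direction.\<close>

locale labelled_square_complex =
  fixes K :: "('v, 'd, 'q) square_complex" and lab :: "'d \<Rightarrow> nat" and side :: "'d \<Rightarrow> bool"
    and k :: nat
  assumes square_complex: "is_square_complex K"
    and lab_less: "d \<in> darts K \<Longrightarrow> lab d < k"
    and lab_flip: "d \<in> darts K \<Longrightarrow> lab (flip K d) = lab d"
    and side_flip: "d \<in> darts K \<Longrightarrow> side (flip K d) \<longleftrightarrow> \<not> side d"
    and lab_opposite: "q \<in> squares K \<Longrightarrow> i < 2 \<Longrightarrow> lab (bdry K q (i + 2)) = lab (bdry K q i)"
    and side_opposite: "q \<in> squares K \<Longrightarrow> i < 2 \<Longrightarrow> side (bdry K q (i + 2)) \<longleftrightarrow> \<not> side (bdry K q i)"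
    and lab_adjacent: "q \<in> squares K \<Longrightarrow> lab (bdry K q 0) \<noteq> lab (bdry K q 1)"
    and dart_eqI: "a \<in> darts K \<Longrightarrow> b \<in> darts K \<Longrightarrow> src K a = src K b \<Longrightarrow> lab a = lab b \<Longrightarrow>
      side a = side b \<Longrightarrow> a = b"
begin

abbreviation "L \<equiv> sheet_cover k lab K"

lemma L_simps [simp]:
  "verts L = verts K \<times> {..<2 ^ k}" "darts L = darts K \<times> {..<2 ^ k}"
  "squares L = squares K \<times> {..<2 ^ k}" "src L (d, n) = (src K d, n)"
  "flip L (d, n) = (flip K d, flip_bit (lab d) n)"
  "bdry L (q, n) i = (bdry K q i, sheet_at_corner (lab \<circ> bdry K q) n i)"
  by (simp_all add: sheet_cover_def)

lemma K_flip [simp]: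
  "d \<in> darts K \<Longrightarrow> flip K d \<in> darts K" "d \<in> darts K \<Longrightarrow> flip K (flip K d) = d"
  and src_in [simp]: "d \<in> darts K \<Longrightarrow> src K d \<in> verts K"
  and K_flip_neq: "d \<in> darts K \<Longrightarrow> flip K d \<noteq> d"
  and bdry_in [simp]: "q \<in> squares K \<Longrightarrow> i < 4 \<Longrightarrow> bdry K q i \<in> darts K"
  and bdry_path: "q \<in> squares K \<Longrightarrow> i < 4 \<Longrightarrow>
    src K (flip K (bdry K q i)) = src K (bdry K q ((i + 1) mod 4))"
  using square_complex by (auto simp: is_square_complex_def tgt_def)

lemma lab_bdry:
  assumes "q \<in> squares K"
  shows "lab (bdry K q 2) = lab (bdry K q 0)" "lab (bdry K q 3) = lab (bdry K q (Suc 0))"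
  using lab_opposite[OF assms, of 0] lab_opposite[OF assms, of 1] by (auto simp: eval_nat_numeral)

lemma side_bdry:
  assumes "q \<in> squares K"
  shows "side (bdry K q 2) \<longleftrightarrow> \<not> side (bdry K q 0)"
    "side (bdry K q 3) \<longleftrightarrow> \<not> side (bdry K q (Suc 0))"
  using side_opposite[OF assms, of 0] side_opposite[OF assms, of 1] by (auto simp: eval_nat_numeral)

lemma sheet_at_corner_simps [simp]:
  "sheet_at_corner l n 0 = n" "sheet_at_corner l n (Suc 0) = flip_bit (l 0) n"
  "sheet_at_corner l n 2 = flip_bit (l (Suc 0)) (flip_bit (l 0) n)"
  "sheet_at_corner l n 3 = flip_bit (l (Suc 0)) n"
  by (simp_all add: sheet_at_corner_def)

lemma sheet_at_corner_less [simp]: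
  assumes "q \<in> squares K" "i < 4" "n < 2 ^ k"
  shows "sheet_at_corner (lab \<circ> bdry K q) n i < 2 ^ k"
  using less_4_cases[OF assms(2)] assms by (auto intro!: flip_bit_less lab_less)

text \<open>Each corner of a square has one lift in every sheet, since passing to a fixed corner permutes
  the sheets.\<close>

lemma sheet_at_corner_involution:
  "i < 4 \<Longrightarrow> sheet_at_corner l (sheet_at_corner l n i) i = n"
  using less_4_cases[of i] by (auto simp: flip_bit_commute[of "l (Suc 0)"])

lemma cover_is_square_complex: "is_square_complex L"
proof -
  have "tgt L (bdry L (q, n) i) = src L (bdry L (q, n) ((i + 1) mod 4))"
    if "q \<in> squares K" "i < 4" for q n i
    using less_4_cases[OF \<open>i < 4\<close>] bdry_path[OF that] lab_bdry[OF \<open>q \<in> squares K\<close>]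
    by (auto simp: tgt_def flip_bit_commute[of "lab (bdry K q (Suc 0))"] simp flip: numeral_2_eq_2)
  then show ?thesis
    by (auto simp: is_square_complex_def lab_flip lab_less K_flip_neq)
qed

lemma cover_covering: "covering_map L K fst fst fst"
proof -
  have "bij_betw fst {d \<in> darts L. src L d = w} {d \<in> darts K. src K d = fst w}"
    if "w \<in> verts L" for w
    using that by (intro bij_betwI[where g = "\<lambda>d. (d, snd w)"]) auto
  moreover have "bij_betw fst {q \<in> squares L. src L (bdry L q i) = w}
      {q \<in> squares K. src K (bdry K q i) = fst w}"
    if "w \<in> verts L" "i < 4" for w i
    using that
    by (intro bij_betwI[where g = "\<lambda>q. (q, sheet_at_corner (lab \<circ> bdry K q) (snd w) i)"])
      (auto simp: sheet_at_corner_involution)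
  moreover have "fst ` verts L = verts K"
    by (simp add: lessThan_empty_iff fst_image_times)
  ultimately show ?thesis
    by (auto simp: covering_map_def simp del: fst_image_times)
qed

text \<open>What codirected darts of the cover have in common.  The last component is the value of the bit
  that the dart is about to flip, and it is what distinguishes start and end of the dart.\<close>

definition transverse_data :: "'d \<times> nat \<Rightarrow> nat \<times> bool \<times> bool" where
  "transverse_data = (\<lambda>(d, n). (lab d, side d, bit n (lab d)))"

text \<open>Opposite edges of a square are separated by edges of a different label, and these do not touch
  the bit of the label in question.\<close>

lemma opposite_transverse_data:
  assumes "opposite L a b"
  shows "transverse_data a = transverse_data b"
proof -
  obtain q n i where q: "q \<in> squares K" and i: "i < 4" and
    ab: "a = bdry L (q, n) i" "b = flip L (bdry L (q, n) ((i + 2) mod 4))"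
    using assms by (auto simp: opposite_def simp del: L_simps(6))
  show ?thesis
    using less_4_cases[OF i] lab_bdry[OF q] side_bdry[OF q] lab_adjacent[OF q]
    by (auto simp: ab transverse_data_def lab_flip side_flip q bit_flip_bit_iff
        simp flip: numeral_2_eq_2)
qed

lemma codirected_transverse_data:
  "codirected L a b \<Longrightarrow> transverse_data a = transverse_data b"
  unfolding codirected_def
  by (induction rule: equivclp_induct) (auto dest: opposite_transverse_data)

lemma parallel_lab:
  assumes "parallel L (d, n) (e, m)" "e \<in> darts K"
  shows "lab e = lab d"
  using assms by (auto simp: parallel_def transverse_data_def lab_flip
      dest!: codirected_transverse_data)

lemma cover_embeds: "embeds L (d, n)"
proof -
  have False if "q \<in> squares K" "i < 4" "parallel L (d, n) (bdry L (q, m) i)"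
    "parallel L (d, n) (bdry L (q, m) ((i + 1) mod 4))" for q m i
  proof -
    have "lab (bdry K q i) = lab (bdry K q ((i + 1) mod 4))"
      using that parallel_lab[of d n "bdry K q i"] parallel_lab[of d n "bdry K q ((i + 1) mod 4)"]
      by simp
    then show False
      using less_4_cases[OF \<open>i < 4\<close>] lab_bdry[OF \<open>q \<in> squares K\<close>]
        lab_adjacent[OF \<open>q \<in> squares K\<close>]
      by (auto simp flip: numeral_2_eq_2)
  qed
  then show ?thesis
    unfolding embeds_def by (auto simp del: L_simps(6))
qed

lemma cover_two_sided:
  assumes "d \<in> darts K"
  shows "two_sided L (d, n)"
  using assms codirected_transverse_data[of "(d, n)" "flip L (d, n)"]
  by (auto simp: two_sided_def transverse_data_def side_flip)

text \<open>A dart of the cover is determined by its source and its transverse data, and likewise by its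
  target, so the darts in question are equal.\<close>

lemma cover_no_direct_self_osculation: "\<not> directly_self_osculates L c"
proof -
  have "(d, n) = (e, m)"
    if "d \<in> darts K" "e \<in> darts K" and eq: "transverse_data (d, n) = transverse_data (e, m)"
      and "src L (d, n) = src L (e, m) \<or> tgt L (d, n) = tgt L (e, m)" for d e n m
  proof (cases "src L (d, n) = src L (e, m)")
    case True
    then show ?thesis
      using that dart_eqI[of d e] by (auto simp: transverse_data_def)
  next
    case False
    then have "tgt L (d, n) = tgt L (e, m)"
      using that by blast
    then have *: "flip L (d, n) = flip L (e, m)"
      using that dart_eqI[of "flip K d" "flip K e"]
      by (auto simp: transverse_data_def tgt_def lab_flip side_flip)
    then have "flip L (flip L (d, n)) = flip L (flip L (e, m))"
      by simp
    then show ?thesis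
      using that by (simp add: lab_flip)
  qed
  note * = this
  have "a = b" if "a \<in> darts L" "b \<in> darts L" "codirected L c a" "codirected L c b"
    "src L a = src L b \<or> tgt L a = tgt L b" for a b
    using that *[of "fst a" "fst b" "snd a" "snd b"] codirected_transverse_data[of c a]
      codirected_transverse_data[of c b]
    by (auto simp del: L_simps(4) simp: mem_Times_iff)
  then show ?thesis
    unfolding directly_self_osculates_def by metis
qed

text \<open>Codirected darts start at the same value of the bit of their label and end at the other one.\<close>

lemma cover_no_indirect_self_osculation: "\<not> indirectly_self_osculates L c"
proof -
  have False if "a \<in> darts L" "b \<in> darts L" "codirected L c a" "codirected L c b"
    "tgt L a = src L b" for a b
    using that codirected_transverse_data[of c a] codirected_transverse_data[of c b]
    by (cases a; cases b) (auto simp: transverse_data_def tgt_def bit_flip_bit_iff)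
  then show ?thesis
    unfolding indirectly_self_osculates_def by metis
qed

lemma virtually_special: "virtually_special K"
proof -
  have "special L"
    using cover_is_square_complex cover_two_sided cover_embeds
      cover_no_direct_self_osculation cover_no_indirect_self_osculation
    by (auto simp: special_def)
  moreover have "finite {w \<in> verts L. fst w = v}" for v
    by (rule finite_subset[of _ "{v} \<times> {..<2 ^ k}"]) auto
  ultimately show ?thesis
    using square_complex cover_covering unfolding virtually_special_def by blast
qed

end

section \<open>Coordinate changes that exchange the axes\<close>

abbreviation box2 :: "real \<Rightarrow> (real \<times> real) set" where
  "box2 a \<equiv> {-a<..<a} \<times> {-a<..<a}"

lemma sign_constant_on_connected:
  fixes G :: "'b::topological_space \<Rightarrow> real"
  assumes "continuous_on H G" "connected H" "\<And>x. x \<in> H \<Longrightarrow> G x \<noteq> 0" "x \<in> H" "y \<in> H"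
  shows "G x > 0 \<longleftrightarrow> G y > 0"
proof -
  have "connected (G ` H)"
    using assms(1,2) by (rule connected_continuous_image)
  moreover have "0 \<notin> G ` H"
    using assms(3) by force
  ultimately show ?thesis
    using assms(4,5) connectedD_interval[of "G ` H" "G x" "G y" 0]
      connectedD_interval[of "G ` H" "G y" "G x" 0]
    by (metis image_eqI less_eq_real_def not_le)
qed

text \<open>\<open>G\<close> has a constant sign on each of the two halves of the square.  These signs are opposite
  because \<open>G\<close> is injective on a segment from one half to the other.\<close>

lemma transverse_sign:
  fixes G :: "real \<times> real \<Rightarrow> real"
  assumes "0 < a" and cont: "continuous_on (box2 a) G"
    and zero: "\<And>u v. (u, v) \<in> box2 a \<Longrightarrow> G (u, v) = 0 \<longleftrightarrow> u = 0"
    and inj: "inj_on (\<lambda>u. G (u, 0)) {-a<..<a}"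
  shows "\<exists>t. \<forall>u v. (u, v) \<in> box2 a \<longrightarrow> u \<noteq> 0 \<longrightarrow> (G (u, v) > 0 \<longleftrightarrow> u > 0) \<longleftrightarrow> t"
proof -
  define c where "c = a / 2"
  have c: "0 < c" "c < a"
    using \<open>0 < a\<close> by (auto simp: c_def)
  have right: "G (u, v) > 0 \<longleftrightarrow> G (c, 0) > 0" if "(u, v) \<in> box2 a" "u > 0" for u v
    using that c zero
    by (intro sign_constant_on_connected[where H = "{0<..<a} \<times> {-a<..<a}"]
        continuous_on_subset[OF cont]) (auto intro!: convex_connected convex_Times)
  have left: "G (u, v) > 0 \<longleftrightarrow> G (-c, 0) > 0" if "(u, v) \<in> box2 a" "u < 0" for u v
    using that c zero
    by (intro sign_constant_on_connected[where H = "{-a<..<0} \<times> {-a<..<a}"]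
        continuous_on_subset[OF cont]) (auto intro!: convex_connected convex_Times)
  have cont0: "continuous_on S (\<lambda>u. G (u, 0))" if "S \<subseteq> {-a<..<a}" for S
    using that c by (intro continuous_on_compose2[OF cont] continuous_intros) auto
  have G0: "G (0, 0) = 0" "G (c, 0) \<noteq> 0" "G (-c, 0) \<noteq> 0"
    using c zero by auto
  \<comment> \<open>If both halves had the same sign, the axis would take a value of that sign close to \<open>0\<close>
    once on each half.\<close>
  have "(G (c, 0) > 0) \<noteq> (G (-c, 0) > 0)"
  proof
    assume same: "(G (c, 0) > 0) = (G (-c, 0) > 0)"
    obtain m where m: "m \<in> closed_segment (G (0, 0)) (G (c, 0))"
      "m \<in> closed_segment (G (0, 0)) (G (-c, 0))" "m \<noteq> 0"
    proof (cases "G (c, 0) > 0")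
      case True
      then show ?thesis
        using same G0 by (intro that[of "min (G (c, 0)) (G (-c, 0))"])
          (auto simp: closed_segment_eq_real_ivl)
    next
      case False
      then show ?thesis
        using same G0 by (intro that[of "max (G (c, 0)) (G (-c, 0))"])
          (auto simp: closed_segment_eq_real_ivl)
    qed
    have "m \<in> (\<lambda>u. G (u, 0)) ` {0..c}"
      using m(1) c connected_continuous_image[OF cont0, of "{0..c}"]
        closed_segment_subset[of "G (0, 0)" "(\<lambda>u. G (u, 0)) ` {0..c}" "G (c, 0)"]
      by (fastforce simp: is_interval_connected_1[symmetric] is_interval_convex_1)
    moreover have "m \<in> (\<lambda>u. G (u, 0)) ` {-c..0}"
      using m(2) c connected_continuous_image[OF cont0, of "{-c..0}"]
        closed_segment_subset[of "G (0, 0)" "(\<lambda>u. G (u, 0)) ` {-c..0}" "G (-c, 0)"]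
      by (fastforce simp: is_interval_connected_1[symmetric] is_interval_convex_1)
    ultimately obtain x y where "G (x, 0) = G (y, 0)" "m = G (x, 0)" "0 \<le> x" "x \<le> c" "-c \<le> y" "y \<le> 0"
      by auto
    then show False
      using m(3) G0 inj_onD[OF inj, of x y] c by auto
  qed
  then show ?thesis
    using left right by (intro exI[of _ "G (c, 0) > 0"]) (metis linorder_neqE_linordered_idom order_less_asym)
qed

text \<open>A coordinate change that exchanges the two axes maps each open quadrant into an open quadrant.
  The truth values \<open>s\<close> and \<open>t\<close> say whether it preserves the orientations of the axes.\<close>

lemma transition_signs:
  fixes T :: "real \<times> real \<Rightarrow> real \<times> real"
  assumes "0 < a" and cont: "continuous_on (box2 a) T" and inj: "inj_on T (box2 a)"
    and snd_T: "\<And>u v. (u, v) \<in> box2 a \<Longrightarrow> snd (T (u, v)) = 0 \<longleftrightarrow> u = 0"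
    and fst_T: "\<And>u v. (u, v) \<in> box2 a \<Longrightarrow> fst (T (u, v)) = 0 \<longleftrightarrow> v = 0"
  shows "\<exists>s t. \<forall>u v. (u, v) \<in> box2 a \<longrightarrow>
    (v \<noteq> 0 \<longrightarrow> ((fst (T (u, v)) > 0 \<longleftrightarrow> v > 0) \<longleftrightarrow> s)) \<and>
    (u \<noteq> 0 \<longrightarrow> ((snd (T (u, v)) > 0 \<longleftrightarrow> u > 0) \<longleftrightarrow> t))"
proof -
  have "inj_on (\<lambda>u. snd (T (u, 0))) {-a<..<a}"
  proof (rule inj_onI)
    fix x y assume "x \<in> {-a<..<a}" "y \<in> {-a<..<a}" "snd (T (x, 0)) = snd (T (y, 0))"
    then show "x = y"
      using \<open>0 < a\<close> fst_T[of x 0] fst_T[of y 0] inj_onD[OF inj, of "(x, 0)" "(y, 0)"]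
      by (auto simp: prod_eq_iff)
  qed
  then have "\<exists>t. \<forall>u v. (u, v) \<in> box2 a \<longrightarrow> u \<noteq> 0 \<longrightarrow> (snd (T (u, v)) > 0 \<longleftrightarrow> u > 0) \<longleftrightarrow> t"
    using \<open>0 < a\<close> snd_T cont by (intro transverse_sign continuous_on_snd) auto
  then obtain t where
    t: "\<And>u v. (u, v) \<in> box2 a \<Longrightarrow> u \<noteq> 0 \<Longrightarrow> (snd (T (u, v)) > 0 \<longleftrightarrow> u > 0) \<longleftrightarrow> t"
    by blast
  have "inj_on (\<lambda>v. fst (T (0, v))) {-a<..<a}"
  proof (rule inj_onI)
    fix x y assume "x \<in> {-a<..<a}" "y \<in> {-a<..<a}" "fst (T (0, x)) = fst (T (0, y))"
    then show "x = y"
      using \<open>0 < a\<close> snd_T[of 0 x] snd_T[of 0 y] inj_onD[OF inj, of "(0, x)" "(0, y)"]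
      by (auto simp: prod_eq_iff)
  qed
  moreover have "continuous_on (box2 a) (\<lambda>x. fst (T (prod.swap x)))"
    by (intro continuous_on_fst continuous_on_compose2[OF cont] continuous_on_swap) auto
  ultimately have "\<exists>s. \<forall>v u. (v, u) \<in> box2 a \<longrightarrow> v \<noteq> 0 \<longrightarrow>
      (fst (T (prod.swap (v, u))) > 0 \<longleftrightarrow> v > 0) \<longleftrightarrow> s"
    using \<open>0 < a\<close> fst_T by (intro transverse_sign) auto
  then obtain s where
    s: "\<And>v u. (v, u) \<in> box2 a \<Longrightarrow> v \<noteq> 0 \<Longrightarrow> (fst (T (u, v)) > 0 \<longleftrightarrow> v > 0) \<longleftrightarrow> s"
    by auto
  show ?thesis
    using s t by (intro exI[of _ s] exI[of _ t]) auto
qed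

text \<open>The inverse takes the argument of the quotient by \<open>z\<close>, which is continuous away from the
  negative real half-line.\<close>

lemma polar_open_embedding:
  assumes "z \<in> circle"
  shows "embedding_map (top_of_set (box2 1)) (top_of_set (circle \<times> {-1<..<1})) (\<lambda>(u, v). (z * cis u, v))"
    and "open_map (top_of_set (box2 1)) (top_of_set (circle \<times> {-1<..<1})) (\<lambda>(u, v). (z * cis u, v))"
proof -
  let ?f = "\<lambda>(u, v). (z * cis u, v :: real)"
  have z: "cmod z = 1" "z \<noteq> 0"
    using assms by auto
  have Arg_polar: "Arg (z * cis u / z) = u" if "u \<in> {-1<..<1}" for u
    using that z pi_gt3 by (simp add: Arg_cis)
  have inj: "inj_on ?f (box2 1)"
  proof (rule inj_onI)
    fix x y assume *: "x \<in> box2 1" "y \<in> box2 1" "?f x = ?f y"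
    then have "z * cis (fst x) / z = z * cis (fst y) / z"
      by (auto simp: case_prod_unfold)
    with * show "x = y"
      using Arg_polar[of "fst x"] Arg_polar[of "fst y"]
      by (simp add: prod_eq_iff case_prod_unfold mem_Times_iff)
  qed
  have cont: "continuous_map (top_of_set (box2 1)) (top_of_set (circle \<times> {-1<..<1})) ?f"
    using z by (auto simp: case_prod_unfold norm_mult intro!: continuous_intros)
  show op: "open_map (top_of_set (box2 1)) (top_of_set (circle \<times> {-1<..<1})) ?f"
  proof -
    have "openin (top_of_set (circle \<times> {-1<..<1})) (?f ` U)"
      if "openin (top_of_set (box2 1)) U" for U
    proof -
      have "open (box2 1)"
        by (intro open_Times open_greaterThanLessThan)
      then have "open U" "U \<subseteq> box2 1"
        using that openin_open_eq[of "box2 1" U] by blast+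
      define P where "P = {x :: complex \<times> real. fst x / z \<notin> \<real>\<^sub>\<le>\<^sub>0}"
      have "P = (\<lambda>x. fst x / z) -` (- \<real>\<^sub>\<le>\<^sub>0)"
        by (auto simp: P_def)
      then have "open P"
        using z by (auto intro!: open_vimage open_Compl closed_nonpos_Reals_complex continuous_intros)
      moreover have "continuous_on P (\<lambda>x. (Arg (fst x / z), snd x))"
        using z by (auto simp: P_def intro!: continuous_intros)
      ultimately have "open ((\<lambda>x. (Arg (fst x / z), snd x)) -` U \<inter> P)"
        using continuous_on_open_vimage \<open>open U\<close> by blast
      moreover have "?f ` U = (circle \<times> {-1<..<1}) \<inter> ((\<lambda>x. (Arg (fst x / z), snd x)) -` U \<inter> P)"
      proof (intro equalityI subsetI)
        fix x assume "x \<in> ?f ` U"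
        then obtain u v where uv: "(u, v) \<in> U" "x = (z * cis u, v)"
          by auto
        then have "(u, v) \<in> box2 1"
          using \<open>U \<subseteq> box2 1\<close> by blast
        moreover have "cis u \<notin> \<real>\<^sub>\<le>\<^sub>0" if "-1 < u" "u < 1"
        proof -
          have "cos u > 0"
            using that pi_gt3 by (intro cos_gt_zero_pi) auto
          then show ?thesis
            by (auto simp: complex_nonpos_Reals_iff)
        qed
        ultimately show "x \<in> (circle \<times> {-1<..<1}) \<inter> ((\<lambda>x. (Arg (fst x / z), snd x)) -` U \<inter> P)"
          using uv z Arg_polar[of u] by (auto simp: P_def norm_mult)
      next
        fix x assume x: "x \<in> (circle \<times> {-1<..<1}) \<inter> ((\<lambda>x. (Arg (fst x / z), snd x)) -` U \<inter> P)"
        then have "fst x \<noteq> 0" "cmod (fst x / z) = 1"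
          using z by (auto simp: norm_divide)
        then have "fst x = z * cis (Arg (fst x / z))"
          using z by (simp add: cis_Arg sgn_eq)
        then show "x \<in> ?f ` U"
          using x by (intro image_eqI[of _ _ "(Arg (fst x / z), snd x)"]) (auto simp: prod_eq_iff)
      qed
      ultimately show ?thesis
        by (auto simp: openin_open)
    qed
    then show ?thesis
      by (simp add: open_map_def)
  qed
  show "embedding_map (top_of_set (box2 1)) (top_of_set (circle \<times> {-1<..<1})) ?f"
    using inj cont op by (intro injective_open_imp_embedding_map) auto
qed

section \<open>Embeddings\<close>

lemma embedding_map_imp_continuous: "embedding_map X Y f \<Longrightarrow> continuous_map X Y f"
  using homeomorphic_imp_continuous_map
  by (fastforce simp: embedding_map_def continuous_map_in_subtopology)

lemma embedding_inverse_continuous: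
  fixes f :: "'b::topological_space \<Rightarrow> 'a"
  assumes emb: "embedding_map (top_of_set S) X f" and "continuous_map Y X g"
    and "g ` topspace Y \<subseteq> f ` S"
  shows "continuous_map Y (top_of_set S) (\<lambda>x. inv_into S f (g x))"
proof -
  obtain k where k: "homeomorphic_maps (top_of_set S) (subtopology X (f ` S)) f k"
    using emb by (auto simp: embedding_map_def homeomorphic_map_maps)
  have "inj_on f S"
    using emb by (metis embedding_map_def homeomorphic_imp_injective_map topspace_euclidean_subtopology)
  have "continuous_map Y (subtopology X (f ` S)) g"
    using assms by (auto simp: continuous_map_in_subtopology)
  then have "continuous_map Y (top_of_set S) (k \<circ> g)"
    using k by (meson continuous_map_compose homeomorphic_maps_def)
  then show ?thesis
  proof (rule continuous_map_eq)
    fix x assume "x \<in> topspace Y"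
    then obtain y where "y \<in> S" "g x = f y"
      using assms by blast
    then show "(k \<circ> g) x = inv_into S f (g x)"
      using k \<open>inj_on f S\<close> by (auto simp: homeomorphic_maps_def)
  qed
qed

lemma connected_inv_into_embedding:
  fixes f :: "'b::topological_space \<Rightarrow> 'a"
  assumes "embedding_map (top_of_set S) X f" "connectedin X Q" "Q \<subseteq> f ` S"
  shows "connected (inv_into S f ` Q)"
proof -
  have "topspace (subtopology X Q) = Q"
    using assms(2) connectedin_subset_topspace by fastforce
  then have "continuous_map (subtopology X Q) (top_of_set S) (inv_into S f)"
    using embedding_inverse_continuous[OF assms(1), of "subtopology X Q" "\<lambda>x. x"] assms(3)
    by (auto simp: continuous_map_from_subtopology)
  moreover have "connectedin (subtopology X Q) Q"
    using assms(2) by (simp add: connectedin_subtopology)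
  ultimately have "connectedin (top_of_set S) (inv_into S f ` Q)"
    by (rule connectedin_continuous_map_image)
  then show ?thesis
    by (simp add: connectedin_subtopology)
qed

lemma open_contains_box2:
  assumes "open S" "(0, 0) \<in> S"
  obtains a where "0 < a" "a \<le> 1" "box2 a \<subseteq> S"
proof -
  obtain e where e: "0 < e" "ball (0, 0) e \<subseteq> S"
    using assms open_contains_ball by blast
  have "(u, v) \<in> S" if "(u, v) \<in> box2 (min 1 (e / 2))" for u v
  proof -
    have "norm (u, v) \<le> \<bar>u\<bar> + \<bar>v\<bar>"
      by (simp add: norm_Pair sqrt_sum_squares_le_sum_abs)
    then have "dist (0, 0) (u, v) < e"
      using that e(1) by (auto simp: dist_norm norm_Pair)
    then show ?thesis
      using e(2) by auto
  qed
  then show ?thesis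
    using e(1) by (intro that[of "min 1 (e / 2)"]) auto
qed

section \<open>Curves with annular neighbourhoods\<close>

text \<open>The topological content of a Heegaard diagram for the dual square complex.  The conditions are
  symmetric in \<open>A\<close> and \<open>B\<close>, so that an argument about two distinct crossing curves need not
  distinguish the families to which they belong.\<close>

locale annular_diagram =
  fixes X :: "'a topology" and A B :: "'a set set" and h :: "'a set \<Rightarrow> complex \<times> real \<Rightarrow> 'a"
  assumes Hausdorff: "Hausdorff_space X" and finite_curves: "finite (A \<union> B)"
    and disjoint_A: "disjoint A" and disjoint_B: "disjoint B"
    and annular: "\<gamma> \<in> A \<union> B \<Longrightarrow> annular_neighbourhood X A B \<gamma> (h \<gamma>)"
    and isolated: "\<alpha> \<in> A \<Longrightarrow> \<beta> \<in> B \<Longrightarrow> p \<in> \<alpha> \<inter> \<beta> \<Longrightarrow> \<exists>W. openin X W \<and> W \<inter> \<alpha> \<inter> \<beta> = {p}"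
begin

abbreviation "annulus \<equiv> circle \<times> {-1<..<1::real}"

abbreviation "curves \<equiv> A \<union> B"

abbreviation "diagram \<equiv> \<Union>curves"

lemma annulus_embedding: "\<gamma> \<in> curves \<Longrightarrow> embedding_map (top_of_set annulus) X (h \<gamma>)"
  using annular by (simp add: annular_neighbourhood_def)

lemma annulus_open_map:
  assumes "\<gamma> \<in> curves"
  shows "open_map (top_of_set annulus) X (h \<gamma>)"
proof -
  have "open_map (top_of_set annulus) (subtopology X (h \<gamma> ` annulus)) (h \<gamma>)"
    using annulus_embedding[OF assms] by (auto simp: embedding_map_def homeomorphic_imp_open_map)
  moreover have "openin X (h \<gamma> ` annulus)"
    using annular[OF assms] by (simp add: annular_neighbourhood_def)
  ultimately show ?thesis
    by (auto simp: open_map_def intro: openin_trans_full)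
qed

lemma annulus_continuous: "\<gamma> \<in> curves \<Longrightarrow> continuous_map (top_of_set annulus) X (h \<gamma>)"
  by (simp add: annulus_embedding embedding_map_imp_continuous)

lemma annulus_inj_on: "\<gamma> \<in> curves \<Longrightarrow> inj_on (h \<gamma>) annulus"
  using annulus_embedding[of \<gamma>]
  by (metis embedding_map_def homeomorphic_imp_injective_map topspace_euclidean_subtopology)

lemma h_eq_iff:
  assumes "\<gamma> \<in> curves" "z \<in> circle" "w \<in> circle" "-1 < v" "v < 1" "-1 < y" "y < 1"
  shows "h \<gamma> (z, v) = h \<gamma> (w, y) \<longleftrightarrow> z = w \<and> v = y"
  using inj_on_eq_iff[OF annulus_inj_on[OF assms(1)], of "(z, v)" "(w, y)"] assms by auto

lemma curve_eq:
  assumes "\<gamma> \<in> curves"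
  shows "\<gamma> = (\<lambda>z. h \<gamma> (z, 0)) ` circle"
proof -
  have "\<gamma> = h \<gamma> ` (circle \<times> {0})"
    using annular[OF assms] by (simp add: annular_neighbourhood_def)
  then show ?thesis
    by (auto simp: image_iff)
qed

lemma h_in_curve_iff:
  assumes "\<gamma> \<in> curves" "z \<in> circle" "-1 < v" "v < 1"
  shows "h \<gamma> (z, v) \<in> \<gamma> \<longleftrightarrow> v = 0"
proof
  assume "h \<gamma> (z, v) \<in> \<gamma>"
  then obtain w where "w \<in> circle" "h \<gamma> (z, v) = h \<gamma> (w, 0)"
    using curve_eq[OF assms(1)] by blast
  then show "v = 0"
    using h_eq_iff[OF assms(1,2), of w v 0] assms by auto
next
  show "h \<gamma> (z, v) \<in> \<gamma>" if "v = 0"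
    using curve_eq[OF assms(1)] assms(2) that by blast
qed

lemma position_h:
  assumes "\<gamma> \<in> curves" "z \<in> circle"
  shows "position (h \<gamma>) (h \<gamma> (z, 0)) = z"
  unfolding position_def using h_eq_iff[OF assms(1)] assms(2) by (intro the_equality) auto

lemma position_curve:
  assumes "\<gamma> \<in> curves" "p \<in> \<gamma>"
  shows "position (h \<gamma>) p \<in> circle" "h \<gamma> (position (h \<gamma>) p, 0) = p"
proof -
  obtain z where "z \<in> circle" "p = h \<gamma> (z, 0)"
    using curve_eq[OF assms(1)] assms(2) by blast
  then show "position (h \<gamma>) p \<in> circle" "h \<gamma> (position (h \<gamma>) p, 0) = p"
    using position_h[OF assms(1)] by auto
qed

lemma closedin_curve:
  assumes "\<gamma> \<in> curves"
  shows "closedin X \<gamma>"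
proof -
  have "compactin (top_of_set annulus) (circle \<times> {0})"
    by (auto simp: compactin_subtopology intro: compact_Times)
  then have "compactin X (h \<gamma> ` (circle \<times> {0}))"
    using annulus_continuous[OF assms] image_compactin by blast
  then have "compactin X \<gamma>"
    using annular[OF assms] by (simp add: annular_neighbourhood_def)
  then show ?thesis
    using Hausdorff compactin_imp_closedin by blast
qed

lemma diagram_subset: "diagram \<subseteq> topspace X"
  using closedin_curve closedin_subset by blast

text \<open>Coordinates around the point \<open>p\<close> of \<open>\<gamma>\<close>: the first one runs along \<open>\<gamma>\<close> in the direction of its
  parametrization, the second one across \<open>\<gamma>\<close> towards its positive side.\<close>

definition chart :: "'a set \<Rightarrow> 'a \<Rightarrow> real \<times> real \<Rightarrow> 'a" where
  "chart \<gamma> p = (\<lambda>(u, v). h \<gamma> (position (h \<gamma>) p * cis u, v))"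

lemma
  assumes "\<gamma> \<in> curves" "p \<in> \<gamma>"
  shows chart_embedding: "embedding_map (top_of_set (box2 1)) X (chart \<gamma> p)"
    and chart_open_map: "open_map (top_of_set (box2 1)) X (chart \<gamma> p)"
proof -
  let ?z = "position (h \<gamma>) p"
  have "chart \<gamma> p = h \<gamma> \<circ> (\<lambda>(u, v). (?z * cis u, v))"
    by (auto simp: chart_def)
  moreover note polar = polar_open_embedding[OF position_curve(1)[OF assms]]
  ultimately show "embedding_map (top_of_set (box2 1)) X (chart \<gamma> p)"
    and "open_map (top_of_set (box2 1)) X (chart \<gamma> p)"
    using embedding_map_compose[OF polar(1) annulus_embedding]
      open_map_compose[OF polar(2) annulus_open_map] assms(1) by simp_all
qed

lemma chart_polar_in_circle:
  "\<gamma> \<in> curves \<Longrightarrow> p \<in> \<gamma> \<Longrightarrow> position (h \<gamma>) p * cis u \<in> circle"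
  using position_curve[of \<gamma> p] by (simp add: norm_mult)

lemma chart_continuous:
  assumes "\<gamma> \<in> curves" "p \<in> \<gamma>" "S \<subseteq> box2 1"
  shows "continuous_map (top_of_set S) X (chart \<gamma> p)"
  using embedding_map_imp_continuous[OF chart_embedding[OF assms(1,2)]] assms(3)
    continuous_map_from_subtopology_mono by blast

lemma chart_0: "\<gamma> \<in> curves \<Longrightarrow> p \<in> \<gamma> \<Longrightarrow> chart \<gamma> p (0, 0) = p"
  using position_curve by (simp add: chart_def)

lemma chart_inj_on: "\<gamma> \<in> curves \<Longrightarrow> p \<in> \<gamma> \<Longrightarrow> inj_on (chart \<gamma> p) (box2 1)"
  using chart_embedding[of \<gamma> p]
  by (metis embedding_map_def homeomorphic_imp_injective_map topspace_euclidean_subtopology)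

lemma chart_eq_iff:
  assumes "\<gamma> \<in> curves" "p \<in> \<gamma>" "(u, v) \<in> box2 1" "(x, y) \<in> box2 1"
  shows "chart \<gamma> p (u, v) = chart \<gamma> p (x, y) \<longleftrightarrow> u = x \<and> v = y"
  using inj_on_eq_iff[OF chart_inj_on[OF assms(1,2)] assms(3,4)] by auto

lemma chart_in_curve_iff:
  assumes "\<gamma> \<in> curves" "p \<in> \<gamma>" "(u, v) \<in> box2 1"
  shows "chart \<gamma> p (u, v) \<in> \<gamma> \<longleftrightarrow> v = 0"
  using assms h_in_curve_iff[OF assms(1) chart_polar_in_circle[OF assms(1,2)], of v u]
  by (auto simp: chart_def)

lemma openin_chart:
  assumes "\<gamma> \<in> curves" "p \<in> \<gamma>" "a \<le> 1"
  shows "openin X (chart \<gamma> p ` box2 a)"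
proof -
  have "open (box2 a)"
    by (intro open_Times open_greaterThanLessThan)
  moreover have "box2 a \<subseteq> box2 1"
    using assms(3) by auto
  ultimately have "openin (top_of_set (box2 1)) (box2 a)"
    by (simp add: open_subset)
  then show ?thesis
    using chart_open_map[OF assms(1,2)] by (auto simp: open_map_def)
qed

lemma chart_shrink:
  assumes "\<gamma> \<in> curves" "p \<in> \<gamma>" "openin X W" "p \<in> W"
  obtains a where "0 < a" "a \<le> 1" "chart \<gamma> p ` box2 a \<subseteq> W"
proof -
  have "openin (top_of_set (box2 1)) {x \<in> box2 1. chart \<gamma> p x \<in> W}"
    using openin_continuous_map_preimage[OF chart_continuous[OF assms(1,2)] assms(3), of "box2 1"] by simp
  moreover have "open (box2 1)"
    by (intro open_Times open_greaterThanLessThan)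
  ultimately have "open {x \<in> box2 1. chart \<gamma> p x \<in> W}"
    by (simp add: openin_open_eq)
  moreover have "(0, 0) \<in> {x \<in> box2 1. chart \<gamma> p x \<in> W}"
    using chart_0[OF assms(1,2)] assms(4) by simp
  ultimately obtain a where "0 < a" "a \<le> 1" "box2 a \<subseteq> {x \<in> box2 1. chart \<gamma> p x \<in> W}"
    by (rule open_contains_box2)
  then show ?thesis
    by (intro that[of a]) auto
qed

lemma not_isolated_on_curve:
  assumes "\<gamma> \<in> curves" "p \<in> \<gamma>" "openin X W" "p \<in> W"
  obtains q where "q \<in> \<gamma> \<inter> W" "q \<noteq> p"
proof -
  obtain a where a: "0 < a" "a \<le> 1" "chart \<gamma> p ` box2 a \<subseteq> W"
    using chart_shrink[OF assms] .
  then have "(a / 2, 0) \<in> box2 a" "(a / 2, 0) \<in> box2 1"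
    by auto
  then show ?thesis
    using a chart_in_curve_iff[OF assms(1,2), of "a / 2" 0]
      chart_eq_iff[OF assms(1,2), of "a / 2" 0 0 0] chart_0[OF assms(1,2)]
    by (intro that[of "chart \<gamma> p (a / 2, 0)"]) auto
qed

lemma avoid_curves:
  assumes "p \<in> topspace X"
  obtains W where "openin X W" "p \<in> W" "\<And>\<epsilon>. \<epsilon> \<in> curves \<Longrightarrow> p \<notin> \<epsilon> \<Longrightarrow> W \<inter> \<epsilon> = {}"
proof -
  have "closedin X (\<Union>{\<epsilon> \<in> curves. p \<notin> \<epsilon>})"
    using finite_curves closedin_curve by (intro closedin_Union) auto
  then show ?thesis
    using assms by (intro that[of "topspace X - \<Union>{\<epsilon> \<in> curves. p \<notin> \<epsilon>}"]) auto
qed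

text \<open>A curve that belongs to both families would meet itself in isolated points only, but no point of
  a curve is isolated on it.\<close>

lemma A_B_disjoint: "A \<inter> B = {}"
proof (rule ccontr)
  assume "A \<inter> B \<noteq> {}"
  then obtain \<gamma> where \<gamma>: "\<gamma> \<in> A" "\<gamma> \<in> B"
    by blast
  moreover have "1 \<in> circle"
    by simp
  ultimately obtain p where p: "p \<in> \<gamma>"
    using curve_eq[of \<gamma>] by blast
  then obtain W where W: "openin X W" "W \<inter> \<gamma> \<inter> \<gamma> = {p}"
    using isolated \<gamma> by blast
  then have "p \<in> W"
    by blast
  then show False
    using not_isolated_on_curve[of \<gamma> p W] \<gamma> p W by blast
qed

lemma same_family_disjoint:
  "\<gamma> \<in> A \<Longrightarrow> \<delta> \<in> A \<Longrightarrow> p \<in> \<gamma> \<Longrightarrow> p \<in> \<delta> \<Longrightarrow> \<gamma> = \<delta>"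
  "\<gamma> \<in> B \<Longrightarrow> \<delta> \<in> B \<Longrightarrow> p \<in> \<gamma> \<Longrightarrow> p \<in> \<delta> \<Longrightarrow> \<gamma> = \<delta>"
  using disjointD[OF disjoint_A] disjointD[OF disjoint_B] by blast+

lemma crossing_iff:
  "p \<in> crossings A B \<longleftrightarrow> (\<exists>\<gamma> \<in> curves. \<exists>\<delta> \<in> curves. \<gamma> \<noteq> \<delta> \<and> p \<in> \<gamma> \<and> p \<in> \<delta>)"
proof
  assume "p \<in> crossings A B"
  then obtain \<gamma> \<delta> where *: "\<gamma> \<in> A" "\<delta> \<in> B" "p \<in> \<gamma>" "p \<in> \<delta>"
    by (auto simp: crossings_def)
  moreover have "\<gamma> \<noteq> \<delta>"
    using * A_B_disjoint by auto
  ultimately show "\<exists>\<gamma> \<in> curves. \<exists>\<delta> \<in> curves. \<gamma> \<noteq> \<delta> \<and> p \<in> \<gamma> \<and> p \<in> \<delta>"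
    by (intro bexI[of _ \<gamma>] bexI[of _ \<delta>]) auto
next
  assume "\<exists>\<gamma> \<in> curves. \<exists>\<delta> \<in> curves. \<gamma> \<noteq> \<delta> \<and> p \<in> \<gamma> \<and> p \<in> \<delta>"
  then obtain \<gamma> \<delta> where *: "\<gamma> \<in> curves" "\<delta> \<in> curves" "\<gamma> \<noteq> \<delta>" "p \<in> \<gamma>" "p \<in> \<delta>"
    by blast
  then have "\<gamma> \<in> A \<and> \<delta> \<in> B \<or> \<gamma> \<in> B \<and> \<delta> \<in> A"
    using same_family_disjoint[of \<gamma> \<delta> p] by auto
  then show "p \<in> crossings A B"
    using * by (auto simp: crossings_def)
qed

lemma crossing_nbhd:
  assumes "\<gamma> \<in> curves" "\<delta> \<in> curves" "\<gamma> \<noteq> \<delta>" "p \<in> \<gamma>" "p \<in> \<delta>"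
  obtains W where "openin X W" "p \<in> W" "W \<inter> \<gamma> \<inter> \<delta> = {p}"
    "\<And>\<epsilon>. \<epsilon> \<in> curves \<Longrightarrow> \<epsilon> \<noteq> \<gamma> \<Longrightarrow> \<epsilon> \<noteq> \<delta> \<Longrightarrow> W \<inter> \<epsilon> = {}"
proof -
  have "\<exists>W. openin X W \<and> W \<inter> \<gamma> \<inter> \<delta> = {p}"
  proof (cases "\<gamma> \<in> A")
    case True
    then have "\<delta> \<in> B"
      using assms same_family_disjoint(1)[of \<gamma> \<delta> p] by auto
    then show ?thesis
      using isolated[of \<gamma> \<delta> p] True assms(4,5) by simp
  next
    case False
    then have "\<gamma> \<in> B" "\<delta> \<in> A"
      using assms same_family_disjoint(2)[of \<gamma> \<delta> p] by auto
    then show ?thesis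
      using isolated[of \<delta> \<gamma> p] assms(4,5) by (simp add: Int_ac)
  qed
  then obtain W where W: "openin X W" "W \<inter> \<gamma> \<inter> \<delta> = {p}"
    by blast
  obtain V where V: "openin X V" "p \<in> V" "\<And>\<epsilon>. \<epsilon> \<in> curves \<Longrightarrow> p \<notin> \<epsilon> \<Longrightarrow> V \<inter> \<epsilon> = {}"
    using avoid_curves[of p] assms(1,4) diagram_subset by (metis UnionI subsetD)
  have "p \<notin> \<epsilon>" if "\<epsilon> \<in> curves" "\<epsilon> \<noteq> \<gamma>" "\<epsilon> \<noteq> \<delta>" for \<epsilon>
    using that assms same_family_disjoint[of \<gamma> \<epsilon> p] same_family_disjoint[of \<delta> \<epsilon> p]
      same_family_disjoint[of \<gamma> \<delta> p] by auto
  then have "(W \<inter> V) \<inter> \<epsilon> = {}" if "\<epsilon> \<in> curves" "\<epsilon> \<noteq> \<gamma>" "\<epsilon> \<noteq> \<delta>" for \<epsilon>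
    using that V(3)[of \<epsilon>] by blast
  moreover have "p \<in> W" "(W \<inter> V) \<inter> \<gamma> \<inter> \<delta> = {p}"
    using W V(2) by blast+
  ultimately show ?thesis
    using W(1) V(1,2) by (intro that[of "W \<inter> V"]) auto
qed

lemma h_in_diagram_fibres:
  assumes "\<gamma> \<in> curves"
  shows "\<exists>C. finite C \<and> C \<subseteq> circle \<and>
    (\<forall>z v. z \<in> circle \<longrightarrow> -1 < v \<longrightarrow> v < 1 \<longrightarrow> (h \<gamma> (z, v) \<in> diagram \<longleftrightarrow> v = 0 \<or> z \<in> C))"
proof -
  obtain C where C: "finite C" "C \<subseteq> circle"
    "h \<gamma> ` annulus \<inter> diagram = h \<gamma> ` (circle \<times> {0} \<union> C \<times> {-1<..<1})"
    using annular[OF assms] unfolding annular_neighbourhood_def by metis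
  have "h \<gamma> (z, v) \<in> diagram \<longleftrightarrow> v = 0 \<or> z \<in> C" if "z \<in> circle" "-1 < v" "v < 1" for z v
  proof -
    have "h \<gamma> (z, v) \<in> diagram \<longleftrightarrow> h \<gamma> (z, v) \<in> h \<gamma> ` (circle \<times> {0} \<union> C \<times> {-1<..<1})"
      using that by (auto simp flip: C(3))
    also have "\<dots> \<longleftrightarrow> (z, v) \<in> circle \<times> {0} \<union> C \<times> {-1<..<1}"
      using that C(2) by (intro inj_on_image_mem_iff[OF annulus_inj_on[OF assms]]) auto
    finally show ?thesis
      using that by auto
  qed
  then show ?thesis
    using C(1,2) by (intro exI[of _ C]) simp
qed

text \<open>The fibres of the annulus that lie in the diagram are exactly those through the crossings.
  Indeed, points of such a fibre off \<open>\<gamma>\<close> lie on finitely many other closed curves, one of which thus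
  contains the limit point on \<open>\<gamma>\<close>.  Conversely, a curve through a point of \<open>\<gamma>\<close> meets \<open>\<gamma>\<close> only there
  locally, so it has to leave \<open>\<gamma>\<close> along a fibre.\<close>

lemma h_in_diagram_iff:
  assumes "\<gamma> \<in> curves" "z \<in> circle" "-1 < v" "v < 1"
  shows "h \<gamma> (z, v) \<in> diagram \<longleftrightarrow> v = 0 \<or> h \<gamma> (z, 0) \<in> crossings A B"
proof -
  obtain C where C: "finite C" "C \<subseteq> circle"
    "\<And>z v. z \<in> circle \<Longrightarrow> -1 < v \<Longrightarrow> v < 1 \<Longrightarrow> h \<gamma> (z, v) \<in> diagram \<longleftrightarrow> v = 0 \<or> z \<in> C"
    using h_in_diagram_fibres[OF assms(1)] by metis
  define p where "p = h \<gamma> (z, 0)"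
  have "p \<in> \<gamma>"
    using curve_eq[OF assms(1)] assms(2) by (auto simp: p_def)
  have pos: "position (h \<gamma>) p = z"
    unfolding p_def by (rule position_h[OF assms(1,2)])
  have "z \<in> C \<longleftrightarrow> p \<in> crossings A B"
  proof
    assume "z \<in> C"
    show "p \<in> crossings A B"
    proof (rule ccontr)
      assume no: "p \<notin> crossings A B"
      obtain W where W: "openin X W" "p \<in> W" "\<And>\<epsilon>. \<epsilon> \<in> curves \<Longrightarrow> p \<notin> \<epsilon> \<Longrightarrow> W \<inter> \<epsilon> = {}"
        using avoid_curves[of p] \<open>p \<in> \<gamma>\<close> assms(1) diagram_subset by (metis UnionI subsetD)
      obtain a where a: "0 < a" "a \<le> 1" "chart \<gamma> p ` box2 a \<subseteq> W"
        using chart_shrink[OF assms(1) \<open>p \<in> \<gamma>\<close> W(1,2)] .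
      have box: "(0, a / 2) \<in> box2 a" "(0, a / 2) \<in> box2 1"
        using a by auto
      then have "chart \<gamma> p (0, a / 2) \<in> W" "chart \<gamma> p (0, a / 2) \<notin> \<gamma>"
        using a chart_in_curve_iff[OF assms(1) \<open>p \<in> \<gamma>\<close>, of 0 "a / 2"] by auto
      moreover have "chart \<gamma> p (0, a / 2) \<in> diagram"
        using C(3)[of z "a / 2"] assms(2) \<open>z \<in> C\<close> a by (auto simp: chart_def pos)
      ultimately obtain \<epsilon> where "\<epsilon> \<in> curves" "\<epsilon> \<noteq> \<gamma>" "W \<inter> \<epsilon> \<noteq> {}"
        by blast
      then show False
        using W(3) no \<open>p \<in> \<gamma>\<close> assms(1) crossing_iff by blast
    qed
  next
    assume "p \<in> crossings A B"
    then obtain \<delta> where \<delta>: "\<delta> \<in> curves" "\<gamma> \<noteq> \<delta>" "p \<in> \<delta>"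
      using crossing_iff \<open>p \<in> \<gamma>\<close> assms(1) by metis
    then obtain W where W: "openin X W" "p \<in> W" "W \<inter> \<gamma> \<inter> \<delta> = {p}"
      using crossing_nbhd[OF assms(1) \<delta>(1,2) \<open>p \<in> \<gamma>\<close> \<delta>(3)] by metis
    show "z \<in> C"
    proof (rule ccontr)
      assume "z \<notin> C"
      \<comment> \<open>Otherwise the diagram coincides with \<open>\<gamma>\<close> near \<open>p\<close>, and \<open>p\<close> is isolated on \<open>\<delta>\<close>.\<close>
      define N where "N = h \<gamma> ` ((circle - C) \<times> {-1<..<1})"
      have "openin (top_of_set annulus) ((circle - C) \<times> {-1<..<1})"
      proof -
        have "open ((- C) \<times> (UNIV :: real set))"
          using C(1) by (intro open_Times) (auto simp: finite_imp_closed)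
        moreover have "(circle - C) \<times> {-1<..<1} = annulus \<inter> (- C) \<times> UNIV"
          by auto
        ultimately show ?thesis
          by (auto simp: openin_open)
      qed
      then have "openin X N"
        using annulus_open_map[OF assms(1)] by (simp add: open_map_def N_def)
      moreover have "p \<in> N"
        using \<open>z \<notin> C\<close> assms(2) by (auto simp: N_def p_def)
      ultimately obtain q where q: "q \<in> \<delta> \<inter> (W \<inter> N)" "q \<noteq> p"
        using not_isolated_on_curve[OF \<delta>(1,3), of "W \<inter> N"] W by blast
      then obtain w v where w: "q = h \<gamma> (w, v)" "w \<in> circle" "w \<notin> C" "-1 < v" "v < 1"
        by (auto simp: N_def)
      moreover have "q \<in> diagram"
        using q \<delta> by blast
      ultimately have "q \<in> \<gamma>"
        using C(3)[of w v] h_in_curve_iff[OF assms(1), of w v] by auto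
      then show False
        using q W(3) by blast
    qed
  qed
  then show ?thesis
    using C(3)[of z v] assms by (simp add: p_def)
qed

end

section \<open>The crossing of two curves in coordinates\<close>

context annular_diagram
begin

text \<open>Near a crossing, the chart of one curve shows the other one as the second coordinate axis.\<close>

lemma chart_in_crossing_curve_iff:
  assumes "\<gamma> \<in> curves" "\<delta> \<in> curves" "\<gamma> \<noteq> \<delta>" "p \<in> \<gamma>" "p \<in> \<delta>"
  obtains a where "0 < a" "a \<le> 1" "\<And>u v. (u, v) \<in> box2 a \<Longrightarrow> chart \<gamma> p (u, v) \<in> \<delta> \<longleftrightarrow> u = 0"
    "\<And>u. u \<noteq> 0 \<Longrightarrow> (u, 0) \<in> box2 a \<Longrightarrow> chart \<gamma> p (u, 0) \<notin> crossings A B"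
proof -
  obtain W where W: "openin X W" "p \<in> W" "W \<inter> \<gamma> \<inter> \<delta> = {p}"
    "\<And>\<epsilon>. \<epsilon> \<in> curves \<Longrightarrow> \<epsilon> \<noteq> \<gamma> \<Longrightarrow> \<epsilon> \<noteq> \<delta> \<Longrightarrow> W \<inter> \<epsilon> = {}"
    using crossing_nbhd[OF assms] by metis
  obtain a where a: "0 < a" "a \<le> 1" "chart \<gamma> p ` box2 a \<subseteq> W"
    using chart_shrink[OF assms(1,4) W(1,2)] .
  have in_W: "chart \<gamma> p (u, v) \<in> W" if "(u, v) \<in> box2 a" for u v
    using a(3) that by blast
  have in_box: "(u, v) \<in> box2 1" if "(u, v) \<in> box2 a" for u v
    using a(2) that by auto
  have p_only: "u = 0 \<and> v = 0"
    if "(u, v) \<in> box2 a" "chart \<gamma> p (u, v) \<in> \<gamma>" "chart \<gamma> p (u, v) \<in> \<delta>" for u v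
  proof -
    have "chart \<gamma> p (u, v) = chart \<gamma> p (0, 0)"
      using that in_W W(3) chart_0[OF assms(1,4)] by auto
    then show ?thesis
      using chart_eq_iff[OF assms(1,4) in_box[OF that(1)], of 0 0] by auto
  qed
  have no_crossing: "chart \<gamma> p (u, 0) \<notin> crossings A B" if "u \<noteq> 0" "(u, 0) \<in> box2 a" for u
  proof
    have \<gamma>: "chart \<gamma> p (u, 0) \<in> \<gamma>"
      using chart_in_curve_iff[OF assms(1,4) in_box[OF that(2)]] by simp
    assume "chart \<gamma> p (u, 0) \<in> crossings A B"
    then obtain \<epsilon> where "\<epsilon> \<in> curves" "\<epsilon> \<noteq> \<gamma>" "chart \<gamma> p (u, 0) \<in> \<epsilon>"
      using crossing_iff by metis
    moreover from this have "\<epsilon> = \<delta>"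
      using W(4)[of \<epsilon>] in_W[OF that(2)] by blast
    ultimately show False
      using p_only[OF that(2) \<gamma>] that(1) by simp
  qed
  have "chart \<gamma> p (u, v) \<in> \<delta> \<longleftrightarrow> u = 0" if uv: "(u, v) \<in> box2 a" for u v
  proof
    assume \<delta>: "chart \<gamma> p (u, v) \<in> \<delta>"
    show "u = 0"
    proof (rule ccontr)
      assume "u \<noteq> 0"
      then have "v = 0"
        using h_in_diagram_iff[OF assms(1) chart_polar_in_circle[OF assms(1,4)], of v u]
          no_crossing[of u] uv \<delta> assms(2) in_box[OF uv] by (auto simp: chart_def)
      then show False
        using chart_in_curve_iff[OF assms(1,4) in_box[OF uv]] p_only[OF uv _ \<delta>] \<open>u \<noteq> 0\<close> by simp
    qed
  next
    assume "u = 0"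
    show "chart \<gamma> p (u, v) \<in> \<delta>"
    proof (cases "v = 0")
      case True
      then show ?thesis
        using \<open>u = 0\<close> chart_0[OF assms(1,4)] assms(5) by simp
    next
      case False
      then have "chart \<gamma> p (u, v) \<notin> \<gamma>"
        using chart_in_curve_iff[OF assms(1,4) in_box[OF uv]] by simp
      moreover have "p \<in> crossings A B"
        using assms crossing_iff by metis
      then have "chart \<gamma> p (u, v) \<in> diagram"
        using h_in_diagram_iff[OF assms(1) chart_polar_in_circle[OF assms(1,4)], of v u]
          \<open>u = 0\<close> in_box[OF uv] position_curve[OF assms(1,4)] by (auto simp: chart_def)
      ultimately obtain \<epsilon> where "\<epsilon> \<in> curves" "\<epsilon> \<noteq> \<gamma>" "chart \<gamma> p (u, v) \<in> \<epsilon>"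
        by auto
      moreover from this have "\<epsilon> = \<delta>"
        using W(4)[of \<epsilon>] in_W[OF uv] by blast
      ultimately show ?thesis
        by simp
    qed
  qed
  then show ?thesis
    using no_crossing by (rule that[OF a(1,2)])
qed

text \<open>The coordinate change \<open>T\<close> between the charts of two curves at a crossing exchanges the axes,
  because each chart has its own curve as first axis and the other curve as second axis.\<close>

lemma crossing_transition_signs:
  assumes "\<gamma> \<in> curves" "\<delta> \<in> curves" "\<gamma> \<noteq> \<delta>" "p \<in> \<gamma>" "p \<in> \<delta>" "0 < b" "b \<le> 1"
  obtains a T s t where "0 < a" "a \<le> 1" "T ` box2 a \<subseteq> box2 b"
    "\<And>x. x \<in> box2 a \<Longrightarrow> chart \<delta> p (T x) = chart \<gamma> p x"
    "\<And>u v. (u, v) \<in> box2 a \<Longrightarrow> snd (T (u, v)) = 0 \<longleftrightarrow> u = 0"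
    "\<And>u v. (u, v) \<in> box2 a \<Longrightarrow> fst (T (u, v)) = 0 \<longleftrightarrow> v = 0"
    "\<And>u v. (u, v) \<in> box2 a \<Longrightarrow> v \<noteq> 0 \<Longrightarrow> (fst (T (u, v)) > 0 \<longleftrightarrow> v > 0) \<longleftrightarrow> s"
    "\<And>u v. (u, v) \<in> box2 a \<Longrightarrow> u \<noteq> 0 \<Longrightarrow> (snd (T (u, v)) > 0 \<longleftrightarrow> u > 0) \<longleftrightarrow> t"
proof -
  obtain a1 where a1: "0 < a1" "a1 \<le> 1"
    "\<And>u v. (u, v) \<in> box2 a1 \<Longrightarrow> chart \<gamma> p (u, v) \<in> \<delta> \<longleftrightarrow> u = 0"
    using chart_in_crossing_curve_iff[OF assms(1-5)] by metis
  obtain b1 where b1: "0 < b1" "b1 \<le> 1"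
    "\<And>u v. (u, v) \<in> box2 b1 \<Longrightarrow> chart \<delta> p (u, v) \<in> \<gamma> \<longleftrightarrow> u = 0"
    using chart_in_crossing_curve_iff[OF assms(2,1) not_sym[OF assms(3)] assms(5,4)] by metis
  define c where "c = min b b1"
  have c: "0 < c" "c \<le> 1" "c \<le> b" "c \<le> b1"
    using assms b1 by (auto simp: c_def)
  have "p \<in> chart \<delta> p ` box2 c"
    using chart_0[OF assms(2,5)] c by (intro image_eqI[of _ _ "(0, 0)"]) auto
  then obtain a2 where a2: "0 < a2" "a2 \<le> 1" "chart \<gamma> p ` box2 a2 \<subseteq> chart \<delta> p ` box2 c"
    using chart_shrink[OF assms(1,4) openin_chart[OF assms(2,5) c(2)]] by metis
  define a where "a = min a1 a2"
  have a: "0 < a" "a \<le> 1" "box2 a \<subseteq> box2 a1" "box2 a \<subseteq> box2 a2" "box2 a \<subseteq> box2 1"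
    using a1 a2 by (auto simp: a_def)
  define T where "T = (\<lambda>x. inv_into (box2 1) (chart \<delta> p) (chart \<gamma> p x))"
  have "box2 c \<subseteq> box2 1"
    using c by auto
  have T: "chart \<delta> p (T x) = chart \<gamma> p x" "T x \<in> box2 c" if x: "x \<in> box2 a" for x
  proof -
    obtain y where y: "y \<in> box2 c" "chart \<gamma> p x = chart \<delta> p y"
      using x a(4) a2(3) by blast
    then have "T x = y"
      using \<open>box2 c \<subseteq> box2 1\<close> inv_into_f_f[OF chart_inj_on[OF assms(2,5)], of y]
      unfolding T_def by auto
    then show "chart \<delta> p (T x) = chart \<gamma> p x" "T x \<in> box2 c"
      using y by auto
  qed
  have "chart \<gamma> p ` box2 a \<subseteq> chart \<delta> p ` box2 1"
    by (rule order.trans[OF image_mono[OF a(4)] order.trans[OF a2(3) image_mono]]) fact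
  then have "continuous_map (top_of_set (box2 a)) (top_of_set (box2 1)) T"
    unfolding T_def
    by (intro embedding_inverse_continuous[OF chart_embedding[OF assms(2,5)]
          chart_continuous[OF assms(1,4) a(5)]]) (simp only: topspace_euclidean_subtopology)
  then have cont: "continuous_on (box2 a) T"
    by simp
  have inj: "inj_on T (box2 a)"
  proof (rule inj_onI)
    fix x y assume "x \<in> box2 a" "y \<in> box2 a" "T x = T y"
    then show "x = y"
      using T(1)[of x] T(1)[of y] inj_onD[OF chart_inj_on[OF assms(1,4)], of x y] a(5) by auto
  qed
  have snd_T: "snd (T (u, v)) = 0 \<longleftrightarrow> u = 0" if uv: "(u, v) \<in> box2 a" for u v
  proof -
    obtain x y where xy: "T (u, v) = (x, y)" "(x, y) \<in> box2 c"
      using T(2)[OF uv] by (cases "T (u, v)") simp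
    have "chart \<delta> p (x, y) = chart \<gamma> p (u, v)"
      using T(1)[OF uv] xy(1) by simp
    moreover have "chart \<delta> p (x, y) \<in> \<delta> \<longleftrightarrow> y = 0"
      using chart_in_curve_iff[OF assms(2,5)] xy(2) \<open>box2 c \<subseteq> box2 1\<close> by blast
    moreover have "chart \<gamma> p (u, v) \<in> \<delta> \<longleftrightarrow> u = 0"
      using a1(3) uv a(3) by blast
    ultimately show ?thesis
      using xy(1) by simp
  qed
  have fst_T: "fst (T (u, v)) = 0 \<longleftrightarrow> v = 0" if uv: "(u, v) \<in> box2 a" for u v
  proof -
    obtain x y where xy: "T (u, v) = (x, y)" "(x, y) \<in> box2 c"
      using T(2)[OF uv] by (cases "T (u, v)") simp
    have "chart \<delta> p (x, y) = chart \<gamma> p (u, v)"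
      using T(1)[OF uv] xy(1) by simp
    moreover have "(x, y) \<in> box2 b1"
      using xy(2) c by auto
    then have "chart \<delta> p (x, y) \<in> \<gamma> \<longleftrightarrow> x = 0"
      by (rule b1(3))
    moreover have "chart \<gamma> p (u, v) \<in> \<gamma> \<longleftrightarrow> v = 0"
      using chart_in_curve_iff[OF assms(1,4)] uv a(5) by blast
    ultimately show ?thesis
      using xy(1) by simp
  qed
  have "\<exists>s t. \<forall>u v. (u, v) \<in> box2 a \<longrightarrow>
      (v \<noteq> 0 \<longrightarrow> ((fst (T (u, v)) > 0 \<longleftrightarrow> v > 0) \<longleftrightarrow> s)) \<and>
      (u \<noteq> 0 \<longrightarrow> ((snd (T (u, v)) > 0 \<longleftrightarrow> u > 0) \<longleftrightarrow> t))"
    by (rule transition_signs[OF a(1) cont inj snd_T fst_T])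
  then obtain s t where st: "\<forall>u v. (u, v) \<in> box2 a \<longrightarrow>
      (v \<noteq> 0 \<longrightarrow> ((fst (T (u, v)) > 0 \<longleftrightarrow> v > 0) \<longleftrightarrow> s)) \<and>
      (u \<noteq> 0 \<longrightarrow> ((snd (T (u, v)) > 0 \<longleftrightarrow> u > 0) \<longleftrightarrow> t))"
    by (elim exE)
  have "T ` box2 a \<subseteq> box2 b"
  proof (rule image_subsetI)
    fix x assume "x \<in> box2 a"
    then show "T x \<in> box2 b"
      using T(2)[of x] c(3) by (auto simp: mem_Times_iff)
  qed
  then show ?thesis
    using snd_T fst_T T(1) st by (intro that[OF a(1,2), of T s t]) simp_all
qed

lemma chart_in_side_part_iff:
  assumes "\<gamma> \<in> curves" "p \<in> \<gamma>" "(u, v) \<in> box2 1"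
  shows "chart \<gamma> p (u, v) \<in> side_part (h \<gamma>) True 1 \<longleftrightarrow> v > 0"
proof -
  have "chart \<gamma> p (u, v) \<in> side_part (h \<gamma>) True 1 \<longleftrightarrow>
      (position (h \<gamma>) p * cis u, v) \<in> circle \<times> {y. 0 < sg True * y \<and> sg True * y < 1}"
    using assms chart_polar_in_circle[OF assms(1,2), of u] unfolding chart_def side_part_def case_prod_conv
    by (intro inj_on_image_mem_iff[OF annulus_inj_on[OF assms(1)]]) (auto simp: sg_def)
  then show ?thesis
    using assms chart_polar_in_circle[OF assms(1,2), of u] by (auto simp: sg_def)
qed

lemma side_enteredI:
  assumes "\<delta> \<in> curves" "p \<in> \<delta>" "0 < c" "c \<le> 1"
    and "\<And>\<tau>. 0 < \<tau> \<Longrightarrow> \<tau> < c \<Longrightarrow> chart \<delta> p (\<tau>, 0) \<in> side_part (h \<gamma>) True 1 \<longleftrightarrow> s"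
  shows "side_entered h \<gamma> \<delta> p \<longleftrightarrow> s"
proof -
  have ev: "\<forall>\<^sub>F \<tau> in at_right 0. (h \<delta> (position (h \<delta>) p * cis \<tau>, 0) \<in> side_part (h \<gamma>) True 1 \<longleftrightarrow> s)"
    using assms(3,5) unfolding eventually_at_right_field
    by (intro exI[of _ c]) (auto simp: chart_def)
  show ?thesis
  proof (cases s)
    case True
    then show ?thesis
      using ev by (simp add: side_entered_def)
  next
    case False
    have "\<not> side_entered h \<gamma> \<delta> p"
    proof
      assume "side_entered h \<gamma> \<delta> p"
      then have "\<forall>\<^sub>F \<tau> in at_right 0.
          h \<delta> (position (h \<delta>) p * cis \<tau>, 0) \<in> side_part (h \<gamma>) True 1"
        by (simp add: side_entered_def)
      from eventually_conj[OF this ev] have "\<forall>\<^sub>F \<tau> in at_right (0 :: real). False"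
        by (rule eventually_mono) (use False in auto)
      then show False
        by simp
    qed
    then show ?thesis
      using False by simp
  qed
qed

text \<open>The two signs of the coordinate change are the sides that the curves enter, since these are
  read off from the forward halves of the axes.\<close>

lemma crossing_transition:
  assumes "\<gamma> \<in> curves" "\<delta> \<in> curves" "\<gamma> \<noteq> \<delta>" "p \<in> \<gamma>" "p \<in> \<delta>" "0 < b" "b \<le> 1"
  obtains a where "0 < a" "a \<le> 1"
    "\<And>u v. (u, v) \<in> box2 a \<Longrightarrow> u \<noteq> 0 \<Longrightarrow> v \<noteq> 0 \<Longrightarrow>
      \<exists>x y. (x, y) \<in> box2 b \<and> x \<noteq> 0 \<and> y \<noteq> 0 \<and> chart \<delta> p (x, y) = chart \<gamma> p (u, v) \<and>
        ((x > 0 \<longleftrightarrow> v > 0) \<longleftrightarrow> side_entered h \<gamma> \<delta> p) \<and>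
        ((y > 0 \<longleftrightarrow> u > 0) \<longleftrightarrow> side_entered h \<delta> \<gamma> p)"
proof (rule crossing_transition_signs[OF assms])
  fix a T s t
  assume a: "0 < a" "a \<le> 1" "T ` box2 a \<subseteq> box2 b"
    and T: "\<And>x. x \<in> box2 a \<Longrightarrow> chart \<delta> p (T x) = chart \<gamma> p x"
    and snd_T: "\<And>u v. (u, v) \<in> box2 a \<Longrightarrow> snd (T (u, v)) = 0 \<longleftrightarrow> u = 0"
    and fst_T: "\<And>u v. (u, v) \<in> box2 a \<Longrightarrow> fst (T (u, v)) = 0 \<longleftrightarrow> v = 0"
    and s: "\<And>u v. (u, v) \<in> box2 a \<Longrightarrow> v \<noteq> 0 \<Longrightarrow> (fst (T (u, v)) > 0 \<longleftrightarrow> v > 0) \<longleftrightarrow> s"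
    and t: "\<And>u v. (u, v) \<in> box2 a \<Longrightarrow> u \<noteq> 0 \<Longrightarrow> (snd (T (u, v)) > 0 \<longleftrightarrow> u > 0) \<longleftrightarrow> t"
  have in_box: "(u, v) \<in> box2 1" if "(u, v) \<in> box2 a" for u v
    using a(2) that by auto
  have T_in: "T x \<in> box2 b" "T x \<in> box2 1" if "x \<in> box2 a" for x
  proof -
    show "T x \<in> box2 b"
      using a(3) that by blast
    then show "T x \<in> box2 1"
      using assms(7) by (auto simp: mem_Times_iff)
  qed
  have "side_entered h \<delta> \<gamma> p \<longleftrightarrow> t"
  proof (rule side_enteredI[OF assms(1,4) a(1,2)])
    fix \<tau> :: real assume \<tau>: "0 < \<tau>" "\<tau> < a"
    then have \<tau>0: "(\<tau>, 0) \<in> box2 a"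
      by auto
    obtain x y where xy: "T (\<tau>, 0) = (x, y)" "(x, y) \<in> box2 1"
      using T_in(2)[OF \<tau>0] by (cases "T (\<tau>, 0)") simp
    then show "chart \<gamma> p (\<tau>, 0) \<in> side_part (h \<delta>) True 1 \<longleftrightarrow> t"
      using chart_in_side_part_iff[OF assms(2,5) xy(2)] T[OF \<tau>0] t[OF \<tau>0] \<tau> by auto
  qed
  moreover have "side_entered h \<gamma> \<delta> p \<longleftrightarrow> s"
  proof -
    have "p \<in> chart \<gamma> p ` box2 a"
      using chart_0[OF assms(1,4)] a by (intro image_eqI[of _ _ "(0, 0)"]) auto
    then obtain c where c: "0 < c" "c \<le> 1" "chart \<delta> p ` box2 c \<subseteq> chart \<gamma> p ` box2 a"
      using chart_shrink[OF assms(2,5) openin_chart[OF assms(1,4) a(2)]] by metis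
    show ?thesis
    proof (rule side_enteredI[OF assms(2,5) c(1,2)])
      fix \<tau> :: real assume \<tau>: "0 < \<tau>" "\<tau> < c"
      then have "chart \<delta> p (\<tau>, 0) \<in> chart \<delta> p ` box2 c"
        by auto
      then obtain u v where uv: "chart \<delta> p (\<tau>, 0) = chart \<gamma> p (u, v)" "(u, v) \<in> box2 a"
        using c(3) by blast
      obtain x y where xy: "T (u, v) = (x, y)" "(x, y) \<in> box2 1"
        using T_in(2)[OF uv(2)] by (cases "T (u, v)") simp
      moreover have "(\<tau>, 0) \<in> box2 1"
        using \<tau> c by auto
      ultimately have "T (u, v) = (\<tau>, 0)"
        using T[OF uv(2)] uv(1) chart_eq_iff[OF assms(2,5), of x y \<tau> 0] by simp
      then show "chart \<delta> p (\<tau>, 0) \<in> side_part (h \<gamma>) True 1 \<longleftrightarrow> s"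
        using uv(1) chart_in_side_part_iff[OF assms(1,4) in_box[OF uv(2)]] fst_T[OF uv(2)]
          s[OF uv(2)] \<tau> by auto
    qed
  qed
  ultimately show ?thesis
  proof (intro that[OF a(1,2)])
    fix u v assume eqs: "side_entered h \<delta> \<gamma> p \<longleftrightarrow> t" "side_entered h \<gamma> \<delta> p \<longleftrightarrow> s"
      and uv: "(u, v) \<in> box2 a" "u \<noteq> 0" "v \<noteq> 0"
    then show "\<exists>x y. (x, y) \<in> box2 b \<and> x \<noteq> 0 \<and> y \<noteq> 0 \<and> chart \<delta> p (x, y) = chart \<gamma> p (u, v) \<and>
        ((x > 0 \<longleftrightarrow> v > 0) \<longleftrightarrow> side_entered h \<gamma> \<delta> p) \<and>
        ((y > 0 \<longleftrightarrow> u > 0) \<longleftrightarrow> side_entered h \<delta> \<gamma> p)"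
      using T[OF uv(1)] T_in(1)[OF uv(1)] snd_T[OF uv(1)] fst_T[OF uv(1)] s[OF uv(1,3)] t[OF uv(1,2)]
      by (intro exI[of _ "fst (T (u, v))"] exI[of _ "snd (T (u, v))"]) simp
  qed
qed

end

section \<open>Arcs and regions\<close>

context annular_diagram
begin

abbreviation "X_arcs \<equiv> subtopology X (diagram - crossings A B)"

abbreviation "X_regions \<equiv> subtopology X (topspace X - diagram)"

lemma topspace_X_arcs: "topspace X_arcs = diagram - crossings A B"
  using diagram_subset by auto

lemma arcs_components: "arcs X A B = connected_components_of X_arcs"
  by (simp add: arcs_def)

lemma regions_components: "regions X A B = connected_components_of X_regions"
  by (simp add: regions_def)

lemma component_eqI:
  assumes "U \<in> connected_components_of Y" "V \<in> connected_components_of Y" "x \<in> U" "x \<in> V"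
  shows "U = V"
  using connected_components_of_overlap[OF assms(1,2)] assms(3,4) by auto

lemma connected_in_component:
  assumes "connectedin Y Q" "Q \<noteq> {}"
  shows "\<exists>U \<in> connected_components_of Y. Q \<subseteq> U"
proof -
  have "Y \<noteq> trivial_topology"
    using connectedin_subset_topspace[OF assms(1)] assms(2) by auto
  then show ?thesis
    using exists_connected_component_of_superset[OF assms(1)] by auto
qed

lemma crossing_free_curve_in_arc:
  assumes "connectedin X Q" "Q \<noteq> {}" "Q \<subseteq> diagram" "Q \<inter> crossings A B = {}"
  shows "\<exists>e \<in> arcs X A B. Q \<subseteq> e"
proof -
  have "connectedin X_arcs Q"
    using assms by (auto simp: connectedin_subtopology)
  then show ?thesis
    unfolding arcs_components using assms(2) by (rule connected_in_component)
qed

lemma arc_subset: "e \<in> arcs X A B \<Longrightarrow> e \<subseteq> diagram - crossings A B"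
  using connected_components_of_subset[of e X_arcs] topspace_X_arcs arcs_components by simp

lemma arc_nonempty: "e \<in> arcs X A B \<Longrightarrow> e \<noteq> {}"
  using nonempty_connected_components_of arcs_components by metis

lemma arc_connected: "e \<in> arcs X A B \<Longrightarrow> connectedin X e"
  using connectedin_connected_components_of[of e X_arcs]
  by (simp add: arcs_components connectedin_subtopology)

lemma region_subset: "U \<in> regions X A B \<Longrightarrow> U \<subseteq> topspace X - diagram"
  using connected_components_of_subset[of U X_regions] regions_components by auto

text \<open>Away from the crossings the finitely many curves are disjoint closed sets, so each of them is
  relatively open and closed in their union.\<close>

lemma arc_in_curve:
  assumes "e \<in> arcs X A B" "\<gamma> \<in> curves" "q \<in> e" "q \<in> \<gamma>"
  shows "e \<subseteq> \<gamma>"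
proof -
  let ?Y = "diagram - crossings A B"
  have "finite (curves - {\<gamma>})"
    using finite_curves by simp
  then have "closedin X (\<Union>(curves - {\<gamma>}))"
    using closedin_curve by (intro closedin_Union) auto
  then have "closedin X_arcs (?Y \<inter> \<Union>(curves - {\<gamma>}))"
    by (rule closedin_subtopology_Int_closed)
  moreover have "?Y - \<gamma> = ?Y \<inter> \<Union>(curves - {\<gamma>})"
  proof (rule equalityI; rule subsetI)
    fix x assume "x \<in> ?Y - \<gamma>"
    then show "x \<in> ?Y \<inter> \<Union>(curves - {\<gamma>})"
      by auto
  next
    fix x assume x: "x \<in> ?Y \<inter> \<Union>(curves - {\<gamma>})"
    then obtain \<delta> where "\<delta> \<in> curves" "\<delta> \<noteq> \<gamma>" "x \<in> \<delta>"
      by auto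
    then show "x \<in> ?Y - \<gamma>"
      using x crossing_iff[of x] assms(2) by auto
  qed
  moreover have "?Y - (?Y \<inter> \<gamma>) = ?Y - \<gamma>"
    by auto
  ultimately have "openin X_arcs (?Y \<inter> \<gamma>)"
    unfolding openin_closedin_eq topspace_X_arcs by auto
  moreover have "closedin X_arcs (?Y \<inter> \<gamma>)"
    using closedin_curve[OF assms(2)] by (rule closedin_subtopology_Int_closed)
  moreover have "connectedin X_arcs e"
    using connectedin_connected_components_of assms(1) arcs_components by metis
  ultimately have "e \<subseteq> ?Y \<inter> \<gamma> \<or> disjnt e (?Y \<inter> \<gamma>)"
    by (intro connectedin_clopen_cases)
  then show ?thesis
    using assms arc_subset[OF assms(1)] by (auto simp: disjnt_iff)
qed

lemma curve_of_arc_eq: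
  assumes "e \<in> arcs X A B" "\<gamma> \<in> curves" "q \<in> e" "q \<in> \<gamma>"
  shows "curve_of_arc A B e = \<gamma>"
  unfolding curve_of_arc_def
proof (rule the_equality)
  show "\<gamma> \<in> curves \<and> e \<subseteq> \<gamma>"
    using arc_in_curve[OF assms] assms(2) by simp
next
  fix \<delta> assume "\<delta> \<in> curves \<and> e \<subseteq> \<delta>"
  then have "\<delta> \<in> curves" "q \<in> \<delta>"
    using assms(3) by auto
  moreover have "q \<notin> crossings A B"
    using arc_subset[OF assms(1)] assms(3) by blast
  ultimately show "\<delta> = \<gamma>"
    using crossing_iff assms(2,4) by metis
qed

lemma curve_of_arc:
  assumes "e \<in> arcs X A B"
  shows "curve_of_arc A B e \<in> curves" "e \<subseteq> curve_of_arc A B e"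
proof -
  obtain q where "q \<in> e"
    using arc_nonempty[OF assms] by auto
  moreover from this obtain \<gamma> where "\<gamma> \<in> curves" "q \<in> \<gamma>"
    using arc_subset[OF assms] by auto
  ultimately show "curve_of_arc A B e \<in> curves" "e \<subseteq> curve_of_arc A B e"
    using curve_of_arc_eq[OF assms] arc_in_curve[OF assms] by simp_all
qed

lemma connectedin_translate:
  assumes "\<gamma> \<in> curves" "connected E" "E \<subseteq> circle" "connected I" "I \<subseteq> {-1<..<1}"
  shows "connectedin X (h \<gamma> ` (E \<times> I))"
proof -
  have "connectedin (top_of_set annulus) (E \<times> I)"
    using assms by (auto simp: connectedin_subtopology connected_Times)
  then show ?thesis
    by (rule connectedin_continuous_map_image[OF annulus_continuous[OF assms(1)]])
qed

text \<open>The annulus is embedded, so an arc is the homeomorphic image of a connected part of the circle.\<close>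

lemma arc_positions:
  assumes "e \<in> arcs X A B" "\<gamma> \<in> curves" "e \<subseteq> \<gamma>"
  defines "E \<equiv> {z \<in> circle. h \<gamma> (z, 0) \<in> e}"
  shows "connected E" "E \<noteq> {}" "e = (\<lambda>z. h \<gamma> (z, 0)) ` E"
proof -
  show e: "e = (\<lambda>z. h \<gamma> (z, 0)) ` E"
  proof (rule equalityI; rule subsetI)
    fix q assume "q \<in> e"
    then show "q \<in> (\<lambda>z. h \<gamma> (z, 0)) ` E"
      using position_curve[OF assms(2), of q] assms(3)
      by (intro image_eqI[of _ _ "position (h \<gamma>) q"]) (auto simp: E_def)
  qed (auto simp: E_def)
  then show "E \<noteq> {}"
    using arc_nonempty[OF assms(1)] by auto
  have "(\<lambda>z. h \<gamma> (z, 0)) ` E \<subseteq> h \<gamma> ` annulus"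
    by (intro image_subsetI) (auto simp: E_def)
  then have "e \<subseteq> h \<gamma> ` annulus"
    by (subst e)
  then have "connected (inv_into annulus (h \<gamma>) ` e)"
    by (rule connected_inv_into_embedding[OF annulus_embedding[OF assms(2)] arc_connected[OF assms(1)]])
  then have "connected (fst ` inv_into annulus (h \<gamma>) ` e)"
    by (intro connected_continuous_image continuous_intros)
  moreover have "inv_into annulus (h \<gamma>) (h \<gamma> (z, 0)) = (z, 0)" if "z \<in> E" for z
    using that by (intro inv_into_f_f[OF annulus_inj_on[OF assms(2)]]) (auto simp: E_def)
  then have "fst ` inv_into annulus (h \<gamma>) ` e = E"
    unfolding e by (force simp: image_image)
  ultimately show "connected E"
    by simp
qed

text \<open>Moving an arc along the fibres of the annulus to one side sweeps out a connected set which
  misses the diagram, because the arc contains no crossing.  It lies in a single region.\<close>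

lemma region_beside:
  assumes "e \<in> arcs X A B" "\<gamma> \<in> curves" "e \<subseteq> \<gamma>"
  shows "region_beside X A B h e s \<in> regions X A B"
    and "\<And>z y. z \<in> circle \<Longrightarrow> h \<gamma> (z, 0) \<in> e \<Longrightarrow> 0 < y \<Longrightarrow> y < 1 \<Longrightarrow>
      h \<gamma> (z, sg s * y) \<in> region_beside X A B h e s"
proof -
  define E where "E = {z \<in> circle. h \<gamma> (z, 0) \<in> e}"
  note E = arc_positions[OF assms, folded E_def]
  have c: "curve_of_arc A B e = \<gamma>"
    using curve_of_arc_eq[OF assms(1,2)] arc_nonempty[OF assms(1)] assms(3) by blast
  define I where "I = {y :: real. 0 < sg s * y \<and> sg s * y < 1}"
  have I: "I = (if s then {0<..<1} else {-1<..<0})"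
    by (auto simp: I_def sg_def)
  define Q where "Q = h \<gamma> ` (E \<times> I)"
  have in_Q: "h \<gamma> (z, sg s * y) \<in> Q" if "z \<in> E" "0 < y" "y < 1" for z y
    using that unfolding Q_def I_def by (intro imageI) (auto simp: sg_def)
  have "connectedin X Q"
    unfolding Q_def using E(1) by (intro connectedin_translate[OF assms(2)]) (auto simp: E_def I)
  moreover have "Q \<inter> diagram = {}"
  proof -
    have "h \<gamma> (z, y) \<notin> diagram" if "z \<in> E" "y \<in> I" for z y
      using h_in_diagram_iff[OF assms(2), of z y] that arc_subset[OF assms(1)]
      by (auto simp: E_def I split: if_splits)
    then show ?thesis
      by (auto simp: Q_def)
  qed
  moreover from calculation have "Q \<subseteq> topspace X - diagram"
    using connectedin_subset_topspace[of X Q] by blast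
  ultimately have Q: "connectedin X_regions Q"
    by (simp add: connectedin_subtopology)
  obtain z0 where z0: "z0 \<in> E"
    using E(2) by auto
  have q0: "h \<gamma> (z0, sg s * (1/2)) \<in> Q"
    using z0 by (intro in_Q) auto
  then obtain U where U: "U \<in> regions X A B" "Q \<subseteq> U"
    using connected_in_component[OF Q] regions_components by auto
  let ?P = "\<lambda>U. U \<in> regions X A B \<and> (\<forall>z \<in> circle. \<forall>y. h (curve_of_arc A B e) (z, 0) \<in> e \<and> 0 < y \<and> y < 1 \<longrightarrow>
      h (curve_of_arc A B e) (z, sg s * y) \<in> U)"
  have "\<exists>!U. ?P U"
  proof (rule ex1I)
    show "?P U"
      using U in_Q by (auto simp: c E_def)
  next
    fix V assume V: "?P V"
    then have "h \<gamma> (z0, sg s * y) \<in> V" if "0 < y" "y < 1" for y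
      using z0 that by (auto simp: c E_def)
    from this[of "1/2"] have "h \<gamma> (z0, sg s * (1/2)) \<in> V"
      by simp
    then show "V = U"
      using V U q0 component_eqI[of V X_regions U] by (auto simp: regions_components)
  qed
  then have "?P (region_beside X A B h e s)"
    unfolding region_beside_def by (rule theI')
  then show "region_beside X A B h e s \<in> regions X A B"
    "\<And>z y. z \<in> circle \<Longrightarrow> h \<gamma> (z, 0) \<in> e \<Longrightarrow> 0 < y \<Longrightarrow> y < 1 \<Longrightarrow>
      h \<gamma> (z, sg s * y) \<in> region_beside X A B h e s"
    by (auto simp: c)
qed

text \<open>Crossings are isolated on \<open>\<gamma>\<close>, so a short segment of \<open>\<gamma>\<close> that leaves \<open>p\<close> is connected and free
  of crossings, and hence contained in one arc.\<close>

lemma arc_from: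
  assumes "\<gamma> \<in> curves" "p \<in> \<gamma>" "p \<in> crossings A B"
  shows "arc_from X A B h \<gamma> p r \<in> arcs X A B"
    and "\<exists>b. 0 < b \<and> b \<le> 1 \<and> (\<forall>t. 0 < t \<and> t < b \<longrightarrow> chart \<gamma> p (sg r * t, 0) \<in> arc_from X A B h \<gamma> p r)"
proof -
  obtain \<delta> where \<delta>: "\<delta> \<in> curves" "\<gamma> \<noteq> \<delta>" "p \<in> \<delta>"
    using assms crossing_iff by metis
  obtain b where b: "0 < b" "b \<le> 1"
    "\<And>u. u \<noteq> 0 \<Longrightarrow> (u, 0) \<in> box2 b \<Longrightarrow> chart \<gamma> p (u, 0) \<notin> crossings A B"
    using chart_in_crossing_curve_iff[OF assms(1) \<delta>(1,2) assms(2) \<delta>(3)] by metis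
  define Q where "Q = (\<lambda>t. chart \<gamma> p (sg r * t, 0)) ` {0<..<b}"
  have sgt: "(sg r * t, 0) \<in> box2 b" "(sg r * t, 0) \<in> box2 1" "sg r * t \<noteq> 0" if "0 < t" "t < b" for t
    using that b by (auto simp: sg_def)
  have conn: "connectedin X Q"
  proof -
    have "continuous_map (top_of_set {0<..<b}) (top_of_set (box2 1)) (\<lambda>t. (sg r * t, 0))"
      using sgt(2) by (auto intro!: continuous_intros)
    then have "continuous_map (top_of_set {0<..<b}) X (chart \<gamma> p \<circ> (\<lambda>t. (sg r * t, 0)))"
      using chart_continuous[OF assms(1,2) order.refl] by (rule continuous_map_compose)
    from connectedin_continuous_map_image[OF this, of "{0<..<b}"] show ?thesis
      by (simp add: Q_def image_comp comp_def connectedin_subtopology)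
  qed
  moreover have "Q \<noteq> {}"
    using b by (simp add: Q_def)
  moreover have "q \<in> \<gamma> \<and> q \<notin> crossings A B" if "q \<in> Q" for q
    using that sgt b(3) chart_in_curve_iff[OF assms(1,2) sgt(2)] by (auto simp: Q_def)
  then have "Q \<subseteq> diagram" "Q \<inter> crossings A B = {}"
    using assms(1) by auto
  ultimately obtain e where e: "e \<in> arcs X A B" "Q \<subseteq> e"
    using crossing_free_curve_in_arc by metis
  then have chart_e: "chart \<gamma> p (sg r * t, 0) \<in> e" if "0 < t" "t < b" for t
    using that by (auto simp: Q_def)
  let ?P = "\<lambda>e. e \<in> arcs X A B \<and>
    (\<forall>\<^sub>F t in at_right 0. h \<gamma> (position (h \<gamma>) p * cis (sg r * t), 0) \<in> e)"
  have "arc_from X A B h \<gamma> p r = e"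
    unfolding arc_from_def
  proof (rule the_equality)
    show "?P e"
      using e chart_e b(1) unfolding eventually_at_right_field by (auto simp: chart_def)
  next
    fix e' assume e': "?P e'"
    then have "\<forall>\<^sub>F t in at_right 0. h \<gamma> (position (h \<gamma>) p * cis (sg r * t), 0) \<in> e'"
      by simp
    then obtain b' where b': "b' > 0"
      "\<And>t. 0 < t \<Longrightarrow> t < b' \<Longrightarrow> h \<gamma> (position (h \<gamma>) p * cis (sg r * t), 0) \<in> e'"
      unfolding eventually_at_right_field by auto
    obtain t where "0 < t" "t < b" "t < b'"
      using b(1) b'(1) dense[of 0 "min b b'"] by auto
    then show "e' = e"
      using chart_e[of t] b'(2)[of t] e' e(1) component_eqI[of e' X_arcs e]
      by (auto simp: chart_def arcs_components)
  qed
  then show "arc_from X A B h \<gamma> p r \<in> arcs X A B"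
    and "\<exists>b. 0 < b \<and> b \<le> 1 \<and> (\<forall>t. 0 < t \<and> t < b \<longrightarrow> chart \<gamma> p (sg r * t, 0) \<in> arc_from X A B h \<gamma> p r)"
    using e chart_e b by auto
qed

lemma arc_from_in_curve:
  assumes "\<gamma> \<in> curves" "p \<in> \<gamma>" "p \<in> crossings A B"
  shows "arc_from X A B h \<gamma> p r \<subseteq> \<gamma>" "curve_of_arc A B (arc_from X A B h \<gamma> p r) = \<gamma>"
proof -
  obtain b where b: "0 < b" "b \<le> 1"
    "\<And>t. 0 < t \<and> t < b \<longrightarrow> chart \<gamma> p (sg r * t, 0) \<in> arc_from X A B h \<gamma> p r"
    using arc_from(2)[OF assms] by metis
  have "chart \<gamma> p (sg r * (b / 2), 0) \<in> arc_from X A B h \<gamma> p r"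
    by (rule b(3)[rule_format]) (use b(1) in simp)
  moreover have "chart \<gamma> p (sg r * (b / 2), 0) \<in> \<gamma>"
    using chart_in_curve_iff[OF assms(1,2), of "sg r * (b / 2)" 0] b by (auto simp: sg_def)
  ultimately show "arc_from X A B h \<gamma> p r \<subseteq> \<gamma>" "curve_of_arc A B (arc_from X A B h \<gamma> p r) = \<gamma>"
    using arc_in_curve[OF arc_from(1)[OF assms] assms(1)]
      curve_of_arc_eq[OF arc_from(1)[OF assms] assms(1)] by blast+
qed

lemma chart_in_region_beside:
  assumes "\<gamma> \<in> curves" "p \<in> \<gamma>" "p \<in> crossings A B"
  obtains b where "0 < b" "b \<le> 1"
    "\<And>u v. (u, v) \<in> box2 b \<Longrightarrow> u \<noteq> 0 \<Longrightarrow> v \<noteq> 0 \<Longrightarrow>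
      chart \<gamma> p (u, v) \<in> region_beside X A B h (arc_from X A B h \<gamma> p (u > 0)) (v > 0)"
proof -
  obtain b1 where b1: "0 < b1" "b1 \<le> 1"
    "\<And>t. 0 < t \<and> t < b1 \<longrightarrow> chart \<gamma> p (sg True * t, 0) \<in> arc_from X A B h \<gamma> p True"
    using arc_from(2)[OF assms] by metis
  obtain b2 where b2: "0 < b2" "b2 \<le> 1"
    "\<And>t. 0 < t \<and> t < b2 \<longrightarrow> chart \<gamma> p (sg False * t, 0) \<in> arc_from X A B h \<gamma> p False"
    using arc_from(2)[OF assms] by metis
  have "chart \<gamma> p (u, v) \<in> region_beside X A B h (arc_from X A B h \<gamma> p (u > 0)) (v > 0)"
    if uv: "(u, v) \<in> box2 (min b1 b2)" "u \<noteq> 0" "v \<noteq> 0" for u v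
  proof -
    have "chart \<gamma> p (u, 0) \<in> arc_from X A B h \<gamma> p (u > 0)"
      using b1(3)[of "\<bar>u\<bar>"] b2(3)[of "\<bar>u\<bar>"] uv by (cases "u > 0") (auto simp: sg_def)
    then have "h \<gamma> (position (h \<gamma>) p * cis u, sg (v > 0) * \<bar>v\<bar>)
        \<in> region_beside X A B h (arc_from X A B h \<gamma> p (u > 0)) (v > 0)"
      using uv b1(2) chart_polar_in_circle[OF assms(1,2)]
      by (intro region_beside(2)[OF arc_from(1)[OF assms] assms(1) arc_from_in_curve(1)[OF assms]])
        (auto simp: chart_def)
    moreover have "sg (v > 0) * \<bar>v\<bar> = v"
      by (auto simp: sg_def)
    ultimately show ?thesis
      by (simp add: chart_def)
  qed
  then show ?thesis
    using b1 b2 by (intro that[of "min b1 b2"]) auto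
qed

text \<open>The direction \<open>r\<close> of \<open>\<gamma>\<close> and the direction \<open>r'\<close> of \<open>\<delta>\<close> bound one of the four quadrants at \<open>p\<close>.
  Both regions contain its points close to \<open>p\<close>: it lies beside the arc of \<open>\<gamma>\<close>, on the side to which
  the direction \<open>r'\<close> of \<open>\<delta>\<close> goes, and conversely.\<close>

lemma quadrant_region:
  assumes "\<gamma> \<in> curves" "\<delta> \<in> curves" "\<gamma> \<noteq> \<delta>" "p \<in> \<gamma>" "p \<in> \<delta>"
  shows "region_beside X A B h (arc_from X A B h \<gamma> p r) (side_entered h \<gamma> \<delta> p \<longleftrightarrow> r') =
    region_beside X A B h (arc_from X A B h \<delta> p r') (side_entered h \<delta> \<gamma> p \<longleftrightarrow> r)"
proof -
  have p: "p \<in> crossings A B"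
    using crossing_iff assms by metis
  show ?thesis
  proof (rule chart_in_region_beside[OF assms(1,4) p], rule chart_in_region_beside[OF assms(2,5) p])
    fix b c
    assume b: "0 < b" "b \<le> 1" "\<And>u v. (u, v) \<in> box2 b \<Longrightarrow> u \<noteq> 0 \<Longrightarrow> v \<noteq> 0 \<Longrightarrow>
        chart \<gamma> p (u, v) \<in> region_beside X A B h (arc_from X A B h \<gamma> p (u > 0)) (v > 0)"
      and c: "0 < c" "c \<le> 1" "\<And>u v. (u, v) \<in> box2 c \<Longrightarrow> u \<noteq> 0 \<Longrightarrow> v \<noteq> 0 \<Longrightarrow>
        chart \<delta> p (u, v) \<in> region_beside X A B h (arc_from X A B h \<delta> p (u > 0)) (v > 0)"
    show ?thesis
    proof (rule crossing_transition[OF assms c(1,2)])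
      fix a
      assume a: "0 < a" "a \<le> 1" "\<And>u v. (u, v) \<in> box2 a \<Longrightarrow> u \<noteq> 0 \<Longrightarrow> v \<noteq> 0 \<Longrightarrow>
        \<exists>x y. (x, y) \<in> box2 c \<and> x \<noteq> 0 \<and> y \<noteq> 0 \<and> chart \<delta> p (x, y) = chart \<gamma> p (u, v) \<and>
          ((x > 0 \<longleftrightarrow> v > 0) \<longleftrightarrow> side_entered h \<gamma> \<delta> p) \<and>
          ((y > 0 \<longleftrightarrow> u > 0) \<longleftrightarrow> side_entered h \<delta> \<gamma> p)"
      define d where "d = min a b / 2"
      define u where "u = sg r * d"
      define v where "v = sg (side_entered h \<gamma> \<delta> p \<longleftrightarrow> r') * d"
      have d: "0 < d" "d < a" "d < b"
        using a(1) b(1) by (auto simp: d_def)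
      then have uv: "(u, v) \<in> box2 a" "(u, v) \<in> box2 b" "u \<noteq> 0" "v \<noteq> 0"
        and uv_sg: "u > 0 \<longleftrightarrow> r" "v > 0 \<longleftrightarrow> (side_entered h \<gamma> \<delta> p \<longleftrightarrow> r')"
        by (auto simp: u_def v_def sg_def)
      obtain x y where xy: "(x, y) \<in> box2 c" "x \<noteq> 0" "y \<noteq> 0" "chart \<delta> p (x, y) = chart \<gamma> p (u, v)"
        "(x > 0 \<longleftrightarrow> v > 0) \<longleftrightarrow> side_entered h \<gamma> \<delta> p" "(y > 0 \<longleftrightarrow> u > 0) \<longleftrightarrow> side_entered h \<delta> \<gamma> p"
        using a(3)[OF uv(1,3,4)] by metis
      have "x > 0 \<longleftrightarrow> r'" "y > 0 \<longleftrightarrow> (side_entered h \<delta> \<gamma> p \<longleftrightarrow> r)"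
        using xy(5,6) uv_sg by argo+
      then show ?thesis
        using b(3)[OF uv(2,3,4)] c(3)[OF xy(1-3)] xy(4) uv_sg
          region_beside(1)[OF arc_from(1)[OF assms(1,4) p] assms(1) arc_from_in_curve(1)[OF assms(1,4) p]]
          region_beside(1)[OF arc_from(1)[OF assms(2,5) p] assms(2) arc_from_in_curve(1)[OF assms(2,5) p]]
        by (intro component_eqI[of _ X_regions _ "chart \<gamma> p (u, v)"])
          (simp_all add: regions_components)
    qed
  qed
qed

text \<open>By tautness the common region meets a thin strip on side \<open>s\<close> of the curve in a connected set.
  Its projection to the curve along the fibres is connected, avoids the crossings and meets both
  arcs, which therefore coincide.\<close>

lemma taut_same_side_unique:
  assumes "taut X A B h" "e \<in> arcs X A B" "e' \<in> arcs X A B"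
    and curve: "curve_of_arc A B e = curve_of_arc A B e'"
    and region: "region_beside X A B h e s = region_beside X A B h e' s"
  shows "e = e'"
proof -
  define \<gamma> where "\<gamma> = curve_of_arc A B e"
  define U where "U = region_beside X A B h e s"
  have \<gamma>: "\<gamma> \<in> curves" "e \<subseteq> \<gamma>" "e' \<subseteq> \<gamma>"
    using curve_of_arc[OF assms(2)] curve_of_arc[OF assms(3)] curve by (auto simp: \<gamma>_def)
  have U: "U \<in> regions X A B"
    using region_beside(1)[OF assms(2) \<gamma>(1,2)] by (simp add: U_def)
  obtain n where "n \<le> 1" "meets_side_in_components X (h \<gamma>) s U n"
    using assms(1) U \<gamma>(1) unfolding taut_def by blast
  then have "\<forall>\<^sub>F \<epsilon> in at_right 0.
      finite (connected_components_of (subtopology X (U \<inter> side_part (h \<gamma>) s \<epsilon>))) \<and>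
      card (connected_components_of (subtopology X (U \<inter> side_part (h \<gamma>) s \<epsilon>))) \<le> 1"
    unfolding meets_side_in_components_def by (elim eventually_mono) auto
  then obtain b where b: "b > 0" "\<And>\<epsilon>. 0 < \<epsilon> \<Longrightarrow> \<epsilon> < b \<Longrightarrow>
      finite (connected_components_of (subtopology X (U \<inter> side_part (h \<gamma>) s \<epsilon>))) \<and>
      card (connected_components_of (subtopology X (U \<inter> side_part (h \<gamma>) s \<epsilon>))) \<le> 1"
    unfolding eventually_at_right_field by auto
  define \<epsilon> where "\<epsilon> = min 1 b / 2"
  have \<epsilon>: "0 < \<epsilon>" "\<epsilon> < 1" "\<epsilon> < b"
    using b(1) by (auto simp: \<epsilon>_def)
  define V where "V = U \<inter> side_part (h \<gamma>) s \<epsilon>"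
  have "V \<subseteq> U"
    by (simp add: V_def)
  have topV: "topspace (subtopology X V) = V"
    using region_subset[OF U] \<open>V \<subseteq> U\<close> by auto
  have near: "\<exists>z \<in> circle. h \<gamma> (z, 0) \<in> a \<and> h \<gamma> (z, sg s * (\<epsilon> / 2)) \<in> V"
    if a: "a \<in> arcs X A B" "a \<subseteq> \<gamma>" "region_beside X A B h a s = U" for a
  proof -
    obtain q where "q \<in> a"
      using arc_nonempty[OF a(1)] by auto
    then have "q \<in> \<gamma>"
      using a(2) by (rule rev_subsetD)
    define z where "z = position (h \<gamma>) q"
    have z: "z \<in> circle" "h \<gamma> (z, 0) \<in> a"
      using position_curve[OF \<gamma>(1) \<open>q \<in> \<gamma>\<close>] \<open>q \<in> a\<close> by (auto simp: z_def)
    then have "h \<gamma> (z, sg s * (\<epsilon> / 2)) \<in> U"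
      using region_beside(2)[OF a(1) \<gamma>(1) a(2), of z "\<epsilon> / 2" s] a(3) \<epsilon> by auto
    moreover have "h \<gamma> (z, sg s * (\<epsilon> / 2)) \<in> side_part (h \<gamma>) s \<epsilon>"
      using z(1) \<epsilon> unfolding side_part_def by (intro imageI) (auto simp: sg_def)
    ultimately show ?thesis
      using z by (auto simp: V_def)
  qed
  obtain z where z: "z \<in> circle" "h \<gamma> (z, 0) \<in> e" "h \<gamma> (z, sg s * (\<epsilon> / 2)) \<in> V"
    using near[OF assms(2) \<gamma>(2)] by (auto simp: U_def)
  obtain z' where z': "z' \<in> circle" "h \<gamma> (z', 0) \<in> e'" "h \<gamma> (z', sg s * (\<epsilon> / 2)) \<in> V"
    using near[OF assms(3) \<gamma>(3)] region by (auto simp: U_def)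
  have V_comps: "K = K'" if "K \<in> connected_components_of (subtopology X V)"
    "K' \<in> connected_components_of (subtopology X V)" for K K'
    using b(2)[OF \<epsilon>(1,3)] that card_le_Suc0_iff_eq unfolding V_def by (metis One_nat_def)
  have "connected_space (subtopology X V)"
  proof -
    have "\<exists>K. connected_components_of (subtopology X V) \<subseteq> {K}"
      using V_comps by blast
    then show ?thesis
      by (simp only: connected_space_iff_components_subset_singleton)
  qed
  then have "connectedin X V"
    using topV by (auto simp: connectedin_def)
  have side_part: "side_part (h \<gamma>) s \<epsilon> \<subseteq> h \<gamma> ` annulus"
    unfolding side_part_def using \<epsilon> by (intro image_mono) (auto simp: sg_def split: if_splits)
  define P where "P = fst ` inv_into annulus (h \<gamma>) ` V"
  have "connected P"
    unfolding P_def using connected_inv_into_embedding[OF annulus_embedding[OF \<gamma>(1)] \<open>connectedin X V\<close>]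
      side_part by (intro connected_continuous_image continuous_intros) (auto simp: V_def)
  have P: "w \<in> circle \<and> h \<gamma> (w, 0) \<notin> crossings A B" if "w \<in> P" for w
  proof -
    obtain q where q: "q \<in> V" "w = fst (inv_into annulus (h \<gamma>) q)"
      using \<open>w \<in> P\<close> by (auto simp: P_def)
    then have "q \<in> h \<gamma> ` annulus"
      using side_part by (auto simp: V_def)
    then obtain x y where xy: "q = h \<gamma> (x, y)" "(x, y) \<in> annulus"
      by auto
    then have "w = x"
      using q(2) inv_into_f_f[OF annulus_inj_on[OF \<gamma>(1)] xy(2)] by simp
    moreover have "q \<notin> diagram"
      using q(1) region_subset[OF U] \<open>V \<subseteq> U\<close> by blast
    ultimately show ?thesis
      using h_in_diagram_iff[OF \<gamma>(1), of x y] xy by auto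
  qed
  have in_P: "w \<in> P" if "w \<in> circle" "h \<gamma> (w, sg s * (\<epsilon> / 2)) \<in> V" for w
  proof -
    have "(w, sg s * (\<epsilon> / 2)) \<in> annulus"
      using that(1) \<epsilon> by (auto simp: sg_def)
    then show ?thesis
      using inv_into_f_f[OF annulus_inj_on[OF \<gamma>(1)]] that(2) unfolding P_def image_image
      by (intro image_eqI[OF _ that(2)]) simp
  qed
  have Q: "connectedin X (h \<gamma> ` (P \<times> {0}))"
    using \<open>connected P\<close> P by (intro connectedin_translate[OF \<gamma>(1)]) auto
  have zP: "h \<gamma> (z, 0) \<in> h \<gamma> ` (P \<times> {0})" "h \<gamma> (z', 0) \<in> h \<gamma> ` (P \<times> {0})"
    using in_P z z' by auto
  have "h \<gamma> ` (P \<times> {0}) \<subseteq> diagram" "h \<gamma> ` (P \<times> {0}) \<inter> crossings A B = {}"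
    using P h_in_curve_iff[OF \<gamma>(1), of _ 0] \<gamma>(1) by auto
  then obtain a where a: "a \<in> arcs X A B" "h \<gamma> ` (P \<times> {0}) \<subseteq> a"
    using crossing_free_curve_in_arc[OF Q] zP by blast
  then have "e = a" "e' = a"
    using z(2) z'(2) zP assms(2,3) component_eqI[of e X_arcs a "h \<gamma> (z, 0)"]
      component_eqI[of e' X_arcs a "h \<gamma> (z', 0)"]
    by (auto simp: arcs_components)
  then show ?thesis
    by simp
qed

end

section \<open>The dual square complex\<close>

context annular_diagram
begin

abbreviation "dual \<equiv> dual_square_complex X A B h"

lemma dual_simps [simp]:
  "verts dual = regions X A B" "darts dual = arcs X A B \<times> UNIV" "squares dual = crossings A B"
  "src dual (e, s) = region_beside X A B h e (\<not> s)" "flip dual (e, s) = (e, \<not> s)"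
  by (simp_all add: dual_square_complex_def)

lemma bdry_dual:
  assumes "\<alpha> \<in> A" "\<beta> \<in> B" "p \<in> \<alpha>" "p \<in> \<beta>"
  shows "bdry dual p 0 = (arc_from X A B h \<alpha> p True, side_entered h \<alpha> \<beta> p)"
    and "bdry dual p (Suc 0) = (arc_from X A B h \<beta> p True, \<not> side_entered h \<beta> \<alpha> p)"
    and "bdry dual p 2 = (arc_from X A B h \<alpha> p False, \<not> side_entered h \<alpha> \<beta> p)"
    and "bdry dual p 3 = (arc_from X A B h \<beta> p False, side_entered h \<beta> \<alpha> p)"
proof -
  have "(THE \<alpha>. \<alpha> \<in> A \<and> p \<in> \<alpha>) = \<alpha>"
  proof (rule the_equality)
    show "\<gamma> = \<alpha>" if "\<gamma> \<in> A \<and> p \<in> \<gamma>" for \<gamma>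
      using same_family_disjoint(1)[of \<gamma> \<alpha> p] that assms(1,3) by (elim conjE)
  qed (use assms in simp)
  moreover have "(THE \<beta>. \<beta> \<in> B \<and> p \<in> \<beta>) = \<beta>"
  proof (rule the_equality)
    show "\<gamma> = \<beta>" if "\<gamma> \<in> B \<and> p \<in> \<gamma>" for \<gamma>
      using same_family_disjoint(2)[of \<gamma> \<beta> p] that assms(2,4) by (elim conjE)
  qed (use assms in simp)
  ultimately show "bdry dual p 0 = (arc_from X A B h \<alpha> p True, side_entered h \<alpha> \<beta> p)"
    "bdry dual p (Suc 0) = (arc_from X A B h \<beta> p True, \<not> side_entered h \<beta> \<alpha> p)"
    "bdry dual p 2 = (arc_from X A B h \<alpha> p False, \<not> side_entered h \<alpha> \<beta> p)"
    "bdry dual p 3 = (arc_from X A B h \<beta> p False, side_entered h \<beta> \<alpha> p)"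
    by (simp_all add: dual_square_complex_def)
qed

lemma crossing_curves:
  assumes "p \<in> crossings A B"
  obtains \<alpha> \<beta> where "\<alpha> \<in> A" "\<beta> \<in> B" "p \<in> \<alpha>" "p \<in> \<beta>" "\<alpha> \<noteq> \<beta>"
proof -
  obtain \<alpha> \<beta> where "\<alpha> \<in> A" "\<beta> \<in> B" "p \<in> \<alpha>" "p \<in> \<beta>"
    using assms by (auto simp: crossings_def)
  moreover from this have "\<alpha> \<noteq> \<beta>"
    using A_B_disjoint by auto
  ultimately show ?thesis
    by (rule that)
qed

text \<open>Consecutive edges of the boundary of a square cross the two arcs that bound a quadrant at the
  crossing, and between the two they pass through the region of that quadrant.\<close>

lemma dual_is_square_complex: "is_square_complex dual"
proof -
  have "bdry dual p i \<in> darts dual \<and> tgt dual (bdry dual p i) = src dual (bdry dual p ((i + 1) mod 4))"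
    if p: "p \<in> crossings A B" and i: "i < 4" for p i
  proof -
    obtain \<alpha> \<beta> where ab: "\<alpha> \<in> A" "\<beta> \<in> B" "p \<in> \<alpha>" "p \<in> \<beta>" "\<alpha> \<noteq> \<beta>"
      using crossing_curves[OF p] .
    then have curves: "\<alpha> \<in> curves" "\<beta> \<in> curves"
      by auto
    note quadrant = quadrant_region[OF curves ab(5,3,4)]
    show ?thesis
      using less_4_cases[OF i] arc_from(1)[OF curves(1) ab(3) p] arc_from(1)[OF curves(2) ab(4) p]
        quadrant[of True True] quadrant[of True False] quadrant[of False True] quadrant[of False False]
      by (auto simp: bdry_dual[OF ab(1-4)] tgt_def simp flip: numeral_2_eq_2)
  qed
  moreover have "region_beside X A B h e s \<in> regions X A B" if "e \<in> arcs X A B" for e s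
    using region_beside(1)[OF that curve_of_arc[OF that]] .
  ultimately show ?thesis
    by (auto simp: is_square_complex_def)
qed

text \<open>The edges are labelled by the curves that they cross.\<close>

lemma dual_virtually_special:
  assumes "taut X A B h"
  shows "virtually_special dual"
proof -
  obtain idx where idx: "bij_betw idx curves {0..<card curves}"
    using ex_bij_betw_finite_nat[OF finite_curves] by auto
  define lab where "lab = (\<lambda>(e :: 'a set, s :: bool). idx (curve_of_arc A B e))"
  have idx_eq: "idx \<gamma> = idx \<delta> \<longleftrightarrow> \<gamma> = \<delta>" if "\<gamma> \<in> curves" "\<delta> \<in> curves" for \<gamma> \<delta>
    using inj_on_eq_iff[OF bij_betw_imp_inj_on[OF idx]] that .
  have labels: "lab (bdry dual p 2) = lab (bdry dual p 0) \<and>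
      lab (bdry dual p 3) = lab (bdry dual p (Suc 0)) \<and>
      lab (bdry dual p 0) \<noteq> lab (bdry dual p (Suc 0)) \<and>
      (snd (bdry dual p 2) \<longleftrightarrow> \<not> snd (bdry dual p 0)) \<and>
      (snd (bdry dual p 3) \<longleftrightarrow> \<not> snd (bdry dual p (Suc 0)))"
    if p: "p \<in> crossings A B" for p
  proof -
    obtain \<alpha> \<beta> where ab: "\<alpha> \<in> A" "\<beta> \<in> B" "p \<in> \<alpha>" "p \<in> \<beta>" "\<alpha> \<noteq> \<beta>"
      using crossing_curves[OF p] .
    then have curves: "\<alpha> \<in> curves" "\<beta> \<in> curves"
      by auto
    show ?thesis
      using arc_from_in_curve(2)[OF curves(1) ab(3) p] arc_from_in_curve(2)[OF curves(2) ab(4) p]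
        idx_eq[OF curves] ab(5)
      by (simp add: bdry_dual[OF ab(1-4)] lab_def)
  qed
  have "labelled_square_complex dual lab snd (card curves)"
  proof
    show "is_square_complex dual"
      by (rule dual_is_square_complex)
    show "lab d < card curves" if "d \<in> darts dual" for d
      using that bij_betwE[OF idx] curve_of_arc(1) by (fastforce simp: lab_def)
    show "lab (flip dual d) = lab d" for d
      by (cases d) (simp add: lab_def)
    show "snd (flip dual d) \<longleftrightarrow> \<not> snd d" for d
      by (cases d) simp
    show "lab (bdry dual q (i + 2)) = lab (bdry dual q i)"
      "snd (bdry dual q (i + 2)) \<longleftrightarrow> \<not> snd (bdry dual q i)" if "q \<in> squares dual" "i < 2" for q i
    proof -
      have "i = 0 \<or> i = 1"
        using \<open>i < 2\<close> by auto
      then show "lab (bdry dual q (i + 2)) = lab (bdry dual q i)"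
        "snd (bdry dual q (i + 2)) \<longleftrightarrow> \<not> snd (bdry dual q i)"
        using labels[of q] \<open>q \<in> squares dual\<close> by (auto simp: eval_nat_numeral)
    qed
    show "lab (bdry dual q 0) \<noteq> lab (bdry dual q 1)" if "q \<in> squares dual" for q
      using labels[of q] that by simp
    show "a = b" if "a \<in> darts dual" "b \<in> darts dual" "src dual a = src dual b" "lab a = lab b"
      "snd a = snd b" for a b
    proof -
      obtain e s e' where ab: "a = (e, s)" "b = (e', s)"
        using \<open>snd a = snd b\<close> by (cases a; cases b) auto
      then have arcs: "e \<in> arcs X A B" "e' \<in> arcs X A B"
        using that by auto
      then have "curve_of_arc A B e = curve_of_arc A B e'"
        using \<open>lab a = lab b\<close> idx_eq[OF curve_of_arc(1) curve_of_arc(1)] by (simp add: ab lab_def)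
      then show ?thesis
        using taut_same_side_unique[OF assms arcs] \<open>src dual a = src dual b\<close> by (simp add: ab)
    qed
  qed
  then show ?thesis
    by (rule labelled_square_complex.virtually_special)
qed

end

lemma crosses_at_isolated:
  assumes "crosses_at X \<gamma> \<delta> p"
  shows "\<exists>W. openin X W \<and> W \<inter> \<gamma> \<inter> \<delta> = {p}"
proof -
  obtain U f where U: "openin X U" and
    f: "homeomorphic_map (euclidean :: complex topology) (subtopology X U) f"
    "f 0 = p" "f ` {z. Im z = 0} = \<gamma> \<inter> U" "f ` {z. Re z = 0} = \<delta> \<inter> U"
    using assms unfolding crosses_at_def by blast
  have "inj f"
    using homeomorphic_imp_injective_map[OF f(1)] by simp
  then have "f ` ({z. Im z = 0} \<inter> {z. Re z = 0}) = (\<gamma> \<inter> U) \<inter> (\<delta> \<inter> U)"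
    by (simp only: image_Int f(3,4))
  moreover have "{z. Im z = 0} \<inter> {z. Re z = 0} = {0}"
    by (auto simp: complex_eq_iff)
  ultimately have "U \<inter> \<gamma> \<inter> \<delta> = {p}"
    using f(2) by auto
  then show ?thesis
    using U by blast
qed

theorem proposition5p1:
  fixes M :: "'a topology" and g :: nat and H1 H2 S :: "'a set"
    and \<A> \<B> :: "'a set set" and h :: "'a set \<Rightarrow> complex \<times> real \<Rightarrow> 'a"
  assumes "heegaard_splitting g M H1 H2 S"
    and "heegaard_diagram g M H1 H2 S \<A> \<B>"
    and "filling (subtopology M S) \<A> \<B>"
    and "annular_neighbourhoods (subtopology M S) \<A> \<B> h"
    and "taut (subtopology M S) \<A> \<B> h"
  shows "virtually_special (dual_square_complex (subtopology M S) \<A> \<B> h)"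
proof -
  have "annular_diagram (subtopology M S) \<A> \<B> h"
  proof
    show "Hausdorff_space (subtopology M S)"
      using assms(1) by (simp add: heegaard_splitting_def closed_manifold_def Hausdorff_space_subtopology)
    show "finite (\<A> \<union> \<B>)" "disjoint \<A>" "disjoint \<B>"
      using assms(2) by (auto simp: heegaard_diagram_def handlebody_curves_def)
    show "annular_neighbourhood (subtopology M S) \<A> \<B> \<gamma> (h \<gamma>)" if "\<gamma> \<in> \<A> \<union> \<B>" for \<gamma>
      using assms(4) that by (simp add: annular_neighbourhoods_def)
    show "\<exists>W. openin (subtopology M S) W \<and> W \<inter> \<alpha> \<inter> \<beta> = {p}"
      if "\<alpha> \<in> \<A>" "\<beta> \<in> \<B>" "p \<in> \<alpha> \<inter> \<beta>" for \<alpha> \<beta> p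
      using assms(2) that by (intro crosses_at_isolated) (auto simp: heegaard_diagram_def)
  qed
  then show ?thesis
    using assms(5) by (rule annular_diagram.dual_virtually_special)
qed

end
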